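(* Let $N\ge1$, $m>0$, $\kappa\ge0$, $\nu_1,\dots,\nu_N\in\mathbb R$, and let $\Theta(t)$ be a solution of the inertial Kuramoto model. (1) If $\Theta(t)$ exhibits finiteness of collisions, then $\Theta(t)$ exhibits asymptotic phase-locking. (2) Suppose $\Theta(t)$ exhibits asymptotic phase-locking. Then, for $i,j\in[N]$, $\theta_i$ and $\theta_j$ can collide infinitely many times only if (a) $\nu_i=\nu_j$, (b) $\lim_{t\to\infty}(\theta_i(t)-\theta_j(t))\in2\pi\mathbb Z$, (c) $m\kappa>\frac14$, and (d) $m\kappa\lim_{t\to\infty}\frac1N\sum_{l=1}^N\cos(\theta_l(t)-\theta_i(t))\ge\frac14$. In particular, if either (a') $\nu_i\ne\nu_j$ for all $i,j\in[N]$ with $i\ne j$, or (b') $\lim_{t\to\infty}(\theta_i(t)-\theta_j(t))\notin2\pi\mathbb Z$ whenever $i,j\in[N]$ with $i\ne j$ and $\nu_i=\nu_j$, or (c') $m\kappa\le\frac14$, or (d') $m\kappa\lim_{t\to\infty}\frac1N\sum_{l=1}^N\cos(\theta_l(t)-\theta_i(t))<\frac14$ whenever $i,j\in[N]$ with $i\ne j$, $\nu_i=\nu_j$ and $\lim_{t\to\infty}(\theta_i(t)-\theta_j(t))\in2\pi\mathbb Z$, then $\Theta(t)$ must exhibit finiteness of collisions.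
   Context: $[N]=\{1,\dots,N\}$. The inertial Kuramoto model is the Cauchy problem $$m\ddot\theta_i+\dot\theta_i=\nu_i+\frac\kappa N\sum_{j=1}^N\sin(\theta_j-\theta_i),\quad t>0,\qquad(\theta_i,\dot\theta_i)(0)=(\theta_i^0,\omega_i^0),\quad i\in[N],$$ with real-valued unknowns $\theta_i$ on $[0,\infty)$; it has a unique global solution, which is real analytic. $\Theta$ exhibits asymptotic phase-locking if $\lim_{t\to\infty}(\theta_i(t)-\theta_j(t))$ exists in $\mathbb R$ for all $i,j\in[N]$. Oscillators $\theta_i$ and $\theta_j$ collide at time $t_0\ge0$ if $t_0$ is an isolated point of the set $\{t\ge0:\theta_i(t)\equiv\theta_j(t)\bmod2\pi\}$ (by analyticity, this set is either discrete in $[0,\infty)$ or all of $[0,\infty)$, the latter requiring $\nu_i=\nu_j$, $\theta_i^0\equiv\theta_j^0\bmod 2\pi$, $\omega_i^0=\omega_j^0$). $\Theta$ exhibits finiteness of collisions if for every pair $i,j$ there are only finitely many times at which $\theta_i$ and $\theta_j$ collide. *)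

theory Defs
  imports "HOL-Analysis.Analysis" "HOL-Library.Real_Mod"
begin

text \<open>
  Oscillators are indexed by \<open>{1..N}\<close>; values of \<open>\<theta> i\<close> for \<open>i\<close> outside this set and of \<open>\<theta> i t\<close>
  for \<open>t < 0\<close> are irrelevant. A solution is a classical one: each phase is continuously
  differentiable on \<open>[0,\<infinity>)\<close> (with a one-sided derivative at \<open>0\<close>, so that the initial frequency
  makes sense), and twice differentiable on \<open>(0,\<infinity>)\<close>, where the equation holds. The functions
  \<open>\<omega>\<close> and \<open>\<alpha>\<close> are the first and second time derivatives.
\<close>

definition inertial_kuramoto_solution ::
    "nat \<Rightarrow> real \<Rightarrow> real \<Rightarrow> (nat \<Rightarrow> real) \<Rightarrow> (nat \<Rightarrow> real) \<Rightarrow> (nat \<Rightarrow> real)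
      \<Rightarrow> (nat \<Rightarrow> real \<Rightarrow> real) \<Rightarrow> bool" where
  "inertial_kuramoto_solution N m \<kappa> \<nu> \<theta>0 \<omega>0 \<theta> \<longleftrightarrow>
    (\<exists>\<omega> \<alpha> :: nat \<Rightarrow> real \<Rightarrow> real. \<forall>i\<in>{1..N}.
       \<theta> i 0 = \<theta>0 i \<and> \<omega> i 0 = \<omega>0 i \<and>
       (\<forall>t\<ge>0. (\<theta> i has_real_derivative \<omega> i t) (at t within {0..})) \<and>
       continuous_on {0..} (\<omega> i) \<and>
       (\<forall>t>0. (\<omega> i has_real_derivative \<alpha> i t) (at t) \<and>
              m * \<alpha> i t + \<omega> i t = \<nu> i + \<kappa> / real N * (\<Sum>j=1..N. sin (\<theta> j t - \<theta> i t))))"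

definition phase_locking :: "nat \<Rightarrow> (nat \<Rightarrow> real \<Rightarrow> real) \<Rightarrow> bool" where
  "phase_locking N \<theta> \<longleftrightarrow>
    (\<forall>i\<in>{1..N}. \<forall>j\<in>{1..N}. \<exists>L. ((\<lambda>t. \<theta> i t - \<theta> j t) \<longlongrightarrow> L) at_top)"

text \<open>
  Only isolated coincidence times count, so oscillators that coincide modulo \<open>2 * pi\<close> for all
  times (in particular \<open>i = j\<close>) never collide.
\<close>

definition collide_at :: "(nat \<Rightarrow> real \<Rightarrow> real) \<Rightarrow> nat \<Rightarrow> nat \<Rightarrow> real \<Rightarrow> bool" where
  "collide_at \<theta> i j t0 \<longleftrightarrow> t0 isolated_in {t. t \<ge> 0 \<and> [\<theta> i t = \<theta> j t] (rmod (2 * pi))}"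

definition finite_collisions :: "nat \<Rightarrow> (nat \<Rightarrow> real \<Rightarrow> real) \<Rightarrow> bool" where
  "finite_collisions N \<theta> \<longleftrightarrow>
    (\<forall>i\<in>{1..N}. \<forall>j\<in>{1..N}. finite {t. collide_at \<theta> i j t})"

definition two_pi_ints :: "real set" where
  "two_pi_ints = {2 * pi * of_int k | k :: int. True}"

end

theory Submission
  imports Defs "HOL-Complex_Analysis.Conformal_Mappings"
begin

text \<open>
  The difference \<open>x = \<theta> i - \<theta> j\<close> of two phases solves
  \<open>m x'' + x' = (\<nu> i - \<nu> j) - 2 \<kappa> c(t) sin (x / 2)\<close>, where \<open>\<bar>c(t)\<bar> \<le> 1\<close> (\<open>pair_ode\<close>). A collision is
  an isolated zero of \<open>sin (x / 2)\<close>.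

  Collisions at phase locking. By Rolle, applied once to \<open>x\<close> and once to \<open>exp (t / m) * x'\<close>, between
  any three times at which \<open>x\<close> takes the same value there is one at which \<open>m x'' + x'\<close> vanishes. If
  the three times run to infinity while \<open>x\<close> tends to a multiple of \<open>2 pi\<close>, this forces
  \<open>\<nu> i = \<nu> j\<close>. Near its limit \<open>x\<close> is then a linear damped oscillator with spring constant tending to
  \<open>\<kappa> C\<close>, where \<open>C\<close> is the limit of \<open>(\<Sum>l. cos (\<theta> l - \<theta> i)) / N\<close>, and such an oscillator has infinitely many isolated
  zeros only if it is not overdamped, that is if \<open>4 m \<kappa> C \<ge> 1\<close>; if \<open>4 m \<kappa> \<le> 1\<close> it is overdamped at
  all times, because the spring constant never exceeds \<open>\<kappa>\<close>
  (\<open>overdamped_zero_between_zeros\<close>, \<open>infinite_collisions_at_phase_locking\<close>). Rolle also replaces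
  analyticity: if coincidence times accumulate at a finite time, then \<open>\<nu> i = \<nu> j\<close>, and there
  \<open>x\<close> has the initial data of a constant solution in \<open>2 pi \<int>\<close>, so it is that solution
  (\<open>accumulating_coincidences_imp_constant_difference\<close>).

  Finitely many collisions imply phase locking. After the last collision, every \<open>x\<close> is either
  constant or confined between two consecutive multiples of \<open>2 pi\<close>, so all differences are bounded.
  Subtracting the mean phase leaves a bounded solution, and the claim becomes that bounded solutions
  have convergent phase differences. The energy has derivative \<open>- (\<Sum>i. (\<omega> i)\<^sup>2)\<close>, so
  Barbalat's lemma gives that frequencies, accelerations and forces \<open>\<nu> i + \<kappa> Im (Z exp (- \<i> \<theta> i))\<close> tend to
  \<open>0\<close>, with \<open>Z\<close> the complex order parameter. The remaining step, usually made with the Lojasiewicz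
  inequality, uses here that a bounded continuous function converges as soon as the set of values
  it takes at arbitrarily late times contains no interval
  (\<open>convergent_if_few_recurrent_values\<close>). For \<open>\<kappa> > 0\<close>:

  \<^item> A value \<open>v\<close> that \<open>\<bar>Z\<bar>\<^sup>2\<close> takes at arbitrarily late times satisfies one of the finitely many
    equations \<open>N v = (\<Sum>i. \<plusminus> sqrt (v - (\<nu> i / \<kappa>)\<^sup>2))\<close>. By the identity theorem for holomorphic
    functions these cannot cover an interval, so \<open>\<bar>Z\<bar>\<^sup>2\<close> converges (\<open>order_sq_converges\<close>).
  \<^item> If the limit is positive, the real and imaginary parts of every \<open>Z exp (- \<i> \<theta> i)\<close> converge, hence
    so do \<open>cos (\<theta> i - \<theta> j)\<close> and \<open>\<theta> i - \<theta> j\<close> (\<open>differences_converge_if_ordered\<close>).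
  \<^item> If the limit is \<open>0\<close>, then all \<open>\<nu> i\<close> vanish and the energy decreases to the maximum of the
    potential. It is thus trapped between \<open>0\<close> and the kinetic energy, so the square root of
    the energy dominates the remaining path length (\<open>phases_converge_if_disordered\<close>). The same
    argument covers \<open>\<kappa> = 0\<close>.
\<close>

section \<open>Convergence of real functions\<close>

lemma frequently_at_top_real:
  "(\<exists>\<^sub>F t in at_top. P t) \<longleftrightarrow> (\<forall>T::real. \<exists>t\<ge>T. P t)"
  unfolding frequently_def eventually_at_top_linorder by auto

text \<open>
  By the intermediate value theorem every value strictly between the limes inferior and the limes
  superior is taken at arbitrarily late times.
\<close>

lemma convergent_if_few_recurrent_values:
  fixes f :: "real \<Rightarrow> real"
  assumes cont: "continuous_on {T..} f"
    and bdd: "\<And>t. t \<ge> T \<Longrightarrow> \<bar>f t\<bar> \<le> B"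
    and few: "\<And>a b. a < b \<Longrightarrow> \<exists>v\<in>{a<..<b}. \<not> (\<exists>\<^sub>F t in at_top. f t = v)"
  shows "\<exists>L. (f \<longlongrightarrow> L) at_top"
proof -
  define A where "A = {v. \<forall>\<^sub>F t in at_top. v \<le> f t}"
  have evT: "\<forall>\<^sub>F t in at_top. t \<ge> T" by (rule eventually_ge_at_top)
  have "-B \<in> A" unfolding A_def using evT bdd by (fastforce elim!: eventually_mono)
  then have ne: "A \<noteq> {}" by blast
  have ub: "v \<le> B" if "v \<in> A" for v
  proof -
    have "\<forall>\<^sub>F t in at_top. v \<le> f t \<and> T \<le> t"
      using that evT unfolding A_def by (simp add: eventually_conj)
    then obtain t where "v \<le> f t" "T \<le> t"
      using eventually_happens[of _ "at_top :: real filter"] by force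
    then show ?thesis using bdd[of t] by linarith
  qed
  then have bA: "bdd_above A" by (rule bdd_aboveI)
  define L where "L = Sup A"
  have "(f \<longlongrightarrow> L) at_top"
  proof (rule order_tendstoI)
    fix a assume "a < L"
    then obtain v where v: "v \<in> A" "a < v" unfolding L_def using less_cSup_iff[OF ne bA] by blast
    then have "\<forall>\<^sub>F t in at_top. v \<le> f t" unfolding A_def by simp
    then show "\<forall>\<^sub>F t in at_top. a < f t" by eventually_elim (use v in linarith)
  next
    fix a assume a: "L < a"
    show "\<forall>\<^sub>F t in at_top. f t < a"
    proof (rule ccontr)
      assume "\<not> ?thesis"
      then have hi: "\<exists>\<^sub>F t in at_top. a \<le> f t" by (simp add: frequently_def not_le)
      have "\<exists>\<^sub>F t in at_top. f t = v" if v: "v \<in> {L<..<a}" for v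
        unfolding frequently_at_top_real
      proof
        fix S
        have "v \<notin> A" using v cSup_upper[OF _ bA] unfolding L_def by force
        then have lo: "\<exists>\<^sub>F t in at_top. f t < v" unfolding A_def by (simp add: frequently_def not_less)
        obtain s where s: "s \<ge> max S T" "f s < v" using lo unfolding frequently_at_top_real by blast
        obtain u where u: "u \<ge> s" "a \<le> f u" using hi unfolding frequently_at_top_real by blast
        obtain x where "s \<le> x" "x \<le> u" "f x = v"
        proof (rule IVT'[of f s v u, THEN exE])
          show "continuous_on {s..u} f" using s by (intro continuous_on_subset[OF cont]) auto
        qed (use s u v in auto)
        then show "\<exists>t\<ge>S. f t = v" using s by (intro exI[of _ x]) auto
      qed
      then show False using few[OF a] by blast
    qed
  qed
  then show ?thesis by blast
qed

lemma convergent_if_image_converges: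
  fixes f :: "real \<Rightarrow> real" and g :: "real \<Rightarrow> real"
  assumes "continuous_on {T..} f" and "\<And>t. t \<ge> T \<Longrightarrow> \<bar>f t\<bar> \<le> B"
    and lim: "((\<lambda>t. g (f t)) \<longlongrightarrow> c) at_top"
    and "\<And>a b. a < b \<Longrightarrow> \<exists>v\<in>{a<..<b}. g v \<noteq> c"
  shows "\<exists>L. (f \<longlongrightarrow> L) at_top"
proof (rule convergent_if_few_recurrent_values[OF assms(1,2)])
  fix a b :: real assume "a < b"
  then obtain v where v: "v \<in> {a<..<b}" "g v \<noteq> c" using assms(4) by blast
  have "\<forall>\<^sub>F t in at_top. g (f t) \<noteq> g v"
    using tendsto_imp_eventually_ne[OF lim v(2)[symmetric]] .
  then have "\<forall>\<^sub>F t in at_top. f t \<noteq> v" by (rule eventually_mono) auto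
  then show "\<exists>v\<in>{a<..<b}. \<not> (\<exists>\<^sub>F t in at_top. f t = v)"
    using v(1) unfolding frequently_def by blast
qed

lemma convergent_if_antimono_bounded_below:
  fixes f :: "real \<Rightarrow> real"
  assumes anti: "\<And>s t. a \<le> s \<Longrightarrow> s \<le> t \<Longrightarrow> f t \<le> f s" and lb: "\<And>t. t \<ge> a \<Longrightarrow> B \<le> f t"
  shows "\<exists>L. (f \<longlongrightarrow> L) at_top \<and> (\<forall>t\<ge>a. L \<le> f t)"
proof -
  define L where "L = Inf (f ` {a..})"
  have bb: "bdd_below (f ` {a..})" using lb by (intro bdd_belowI[of _ B]) auto
  have low: "L \<le> f t" if "t \<ge> a" for t
    unfolding L_def using bb that by (intro cInf_lower) auto
  have "(f \<longlongrightarrow> L) at_top"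
  proof (rule order_tendstoI)
    fix x assume "x < L"
    then show "\<forall>\<^sub>F t in at_top. x < f t"
      by (rule eventually_mono[OF eventually_ge_at_top[of a] less_le_trans[OF _ low]])
  next
    fix x assume "L < x"
    then obtain s where s: "s \<ge> a" "f s < x"
      unfolding L_def using cInf_less_iff[OF _ bb] by auto
    show "\<forall>\<^sub>F t in at_top. f t < x"
      using eventually_ge_at_top[of s]
    proof eventually_elim
      case (elim t)
      then show ?case using anti[OF s(1) elim] s(2) by linarith
    qed
  qed
  with low show ?thesis by blast
qed

text \<open>
  On a window of fixed length \<open>h\<close> the derivative \<open>g\<close> varies by at most \<open>B * h\<close>, so \<open>g t\<close> is within
  \<open>B * h\<close> of the difference quotient of \<open>f\<close>, and that quotient tends to \<open>0\<close>.
\<close>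

lemma barbalat:
  fixes f g g' :: "real \<Rightarrow> real"
  assumes lim: "(f \<longlongrightarrow> L) at_top"
    and f: "\<And>t. t > 0 \<Longrightarrow> (f has_real_derivative g t) (at t)"
    and g: "\<And>t. t > 0 \<Longrightarrow> (g has_real_derivative g' t) (at t)"
    and bdd: "\<And>t. t > 0 \<Longrightarrow> \<bar>g' t\<bar> \<le> B"
  shows "(g \<longlongrightarrow> 0) at_top"
proof (rule tendstoI)
  fix e :: real assume e: "e > 0"
  have B: "B \<ge> 0" using bdd[of 1] by linarith
  define h where "h = e / (2 * (B + 1))"
  have h: "h > 0" "h * B \<le> e / 2" unfolding h_def using e B by (auto simp: field_simps)
  have step: "\<bar>g t\<bar> \<le> \<bar>f (t + h) - f t\<bar> / h + e / 2" if t: "t > 0" for t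
  proof -
    obtain z where z: "z > t" "z < t + h" "f (t + h) - f t = h * g z"
      using MVT2[of t "t + h" f g] f h t by auto
    obtain y where y: "y > t" "y < z" "g z - g t = (z - t) * g' y"
      using MVT2[of t z g g'] g z t by auto
    have "\<bar>g z - g t\<bar> = (z - t) * \<bar>g' y\<bar>" using y z by (simp add: abs_mult)
    also have "\<dots> \<le> h * B" using z y t bdd[of y] by (intro mult_mono) auto
    finally have "\<bar>g t\<bar> \<le> \<bar>g z\<bar> + e / 2" using h by linarith
    also have "g z = (f (t + h) - f t) / h" using z h by simp
    finally show ?thesis using h by simp
  qed
  have "((\<lambda>t. f (t + h)) \<longlongrightarrow> L) at_top"
    using filterlim_compose[OF lim filterlim_tendsto_add_at_top[OF tendsto_const[of h] filterlim_ident]]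
    by (simp add: add.commute)
  then have "((\<lambda>t. \<bar>f (t + h) - f t\<bar> / h) \<longlongrightarrow> \<bar>L - L\<bar> / h) at_top"
    by (intro tendsto_intros lim) (use h in auto)
  then have "\<forall>\<^sub>F t in at_top. \<bar>f (t + h) - f t\<bar> / h < e / 2"
    using e by (intro order_tendstoD) auto
  then show "\<forall>\<^sub>F t in at_top. dist (g t) 0 < e"
    using eventually_gt_at_top[of 0]
  proof eventually_elim
    case (elim t)
    then have "\<bar>g t\<bar> < e" using step[of t] by linarith
    then show ?case by (simp add: dist_real_def)
  qed
qed

lemma cos_not_constant_on_interval:
  fixes a b c :: real
  assumes "a < b"
  shows "\<exists>v\<in>{a<..<b}. cos v \<noteq> c"
proof (rule ccontr)
  assume "\<not> ?thesis"
  then have const: "cos v = c" if "v \<in> {a<..<b}" for v using that by blast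
  have s: "sin v = 0" if "v \<in> {a<..<b}" for v
  proof -
    have "((\<lambda>_. c) has_real_derivative - sin v) (at v)"
      by (rule has_field_derivative_transform_within_open[of cos _ _ "{a<..<b}"])
        (use that const in \<open>auto intro!: derivative_eq_intros\<close>)
    then show ?thesis using DERIV_unique[OF _ DERIV_const] by fastforce
  qed
  have c: "cos v = 0" if "v \<in> {a<..<b}" for v
  proof -
    have "((\<lambda>_. 0) has_real_derivative cos v) (at v)"
      by (rule has_field_derivative_transform_within_open[of sin _ _ "{a<..<b}"])
        (use that s in \<open>auto intro!: derivative_eq_intros\<close>)
    then show ?thesis using DERIV_unique[OF _ DERIV_const] by fastforce
  qed
  show False using s[of "(a + b) / 2"] c[of "(a + b) / 2"] sin_cos_squared_add[of "(a + b) / 2"] assms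
    by simp
qed

text \<open>
  The product extends to a holomorphic function on the half-plane to the right of \<open>p\<close>; if it vanished
  on an interval it would vanish on the whole half-plane, but for large real \<open>v\<close> the linear term
  dominates every signed sum of square roots. Multiplying over all sign patterns avoids
  having to choose one pattern that works on an infinite set.
\<close>

lemma signed_sqrt_sums_not_vanishing_on_interval:
  fixes b :: "'i \<Rightarrow> real" and p q :: real
  assumes fin: "finite I" and ne: "I \<noteq> {}" and pq: "p < q"
    and b0: "\<And>i. i \<in> I \<Longrightarrow> 0 \<le> b i" and bp: "\<And>i. i \<in> I \<Longrightarrow> b i \<le> p"
  shows "\<exists>v\<in>{p<..<q}. (\<Prod>J\<in>Pow I. real (card I) * v -
           (\<Sum>i\<in>I. (if i \<in> J then 1 else - 1) * sqrt (v - b i))) \<noteq> 0"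
proof (rule ccontr)
  define H :: "complex \<Rightarrow> complex" where "H = (\<lambda>z. \<Prod>J\<in>Pow I. of_nat (card I) * z -
           (\<Sum>i\<in>I. (if i \<in> J then 1 else - 1) * csqrt (z - of_real (b i))))"
  define h :: "real \<Rightarrow> real" where "h = (\<lambda>v. \<Prod>J\<in>Pow I. real (card I) * v -
           (\<Sum>i\<in>I. (if i \<in> J then 1 else - 1) * sqrt (v - b i)))"
  have Hh: "H (of_real v) = of_real (h v)" if v: "v > p" for v
  proof -
    have "(\<Sum>i\<in>I. (if i \<in> J then 1 else - 1) * csqrt (of_real v - of_real (b i))) =
      of_real (\<Sum>i\<in>I. (if i \<in> J then 1 else - 1) * sqrt (v - b i))" for J
      unfolding of_real_sum
    proof (rule sum.cong[OF refl])
      fix i assume "i \<in> I"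
      then have "csqrt (of_real (v - b i)) = of_real (sqrt (v - b i))"
        using bp[of i] v by (intro csqrt_of_real) auto
      then show "(if i \<in> J then 1 else - 1) * csqrt (of_real v - of_real (b i)) =
        of_real ((if i \<in> J then 1 else - 1) * sqrt (v - b i))" by simp
    qed
    then show ?thesis unfolding H_def h_def by simp
  qed
  assume "\<not> ?thesis"
  then have zero: "h v = 0" if "v \<in> {p<..<q}" for v using that unfolding h_def by blast
  define S where "S = {z::complex. Re z > p}"
  have holo: "H holomorphic_on S"
    unfolding H_def S_def
  proof (intro holomorphic_intros holomorphic_on_csqrt')
    fix J i z assume "i \<in> I" "z \<in> {z. p < Re z}"
    then show "z - of_real (b i) \<notin> \<real>\<^sub>\<le>\<^sub>0"
      using bp[of i] by (auto simp: complex_nonpos_Reals_iff)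
  qed
  have S: "open S" "connected S"
    unfolding S_def by (auto intro: open_halfspace_Re_gt convex_connected convex_halfspace_Re_gt)
  let ?U = "complex_of_real ` {p<..<q}"
  let ?c = "complex_of_real ((p + q) / 2)"
  have lp: "?c islimpt ?U"
  proof -
    have "(p + q) / 2 islimpt {p<..<q}" using pq
      by (intro open_imp_islimpt) auto
    moreover have "isCont complex_of_real ((p + q) / 2)" by simp
    moreover have "\<forall>\<^sub>F x in at ((p + q) / 2). complex_of_real x \<noteq> ?c"
      unfolding eventually_at_filter of_real_eq_iff by simp
    ultimately show ?thesis by (rule islimpt_isCont_image)
  qed
  have van: "H w = 0" if "w \<in> S" for w
  proof (rule analytic_continuation[OF holo S _ _ lp _ that])
    show "?U \<subseteq> S" "?c \<in> S" using pq by (auto simp: S_def)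
    show "H z = 0" if "z \<in> ?U" for z using that Hh zero by auto
  qed
  define v where "v = max p 1 + 1"
  have v: "v > p" "v > 1" unfolding v_def by auto
  have n: "real (card I) > 0" using fin ne by (simp add: card_gt_0_iff)
  have "h v \<noteq> 0"
  proof -
    have "real (card I) * v - (\<Sum>i\<in>I. (if i \<in> J then 1 else - 1) * sqrt (v - b i)) \<noteq> 0" for J
    proof -
      have "(\<Sum>i\<in>I. (if i \<in> J then 1 else - 1) * sqrt (v - b i)) \<le> (\<Sum>i\<in>I. sqrt v)"
      proof (rule sum_mono)
        fix i assume i: "i \<in> I"
        have "(if i \<in> J then 1 else - 1) * sqrt (v - b i) \<le> \<bar>sqrt (v - b i)\<bar>" by auto
        also have "\<dots> \<le> sqrt v" using b0[OF i] bp[OF i] v by simp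
        finally show "(if i \<in> J then 1 else - 1) * sqrt (v - b i) \<le> sqrt v" .
      qed
      also have "\<dots> = real (card I) * sqrt v" by simp
      also have "\<dots> < real (card I) * v"
        using n v real_less_lsqrt[of v v] by (simp add: power2_eq_square)
      finally show ?thesis by simp
    qed
    then show ?thesis unfolding h_def using fin by simp
  qed
  moreover have "H (of_real v) = 0" by (rule van) (use v in \<open>auto simp: S_def\<close>)
  ultimately show False using Hh[OF v(1)] by simp
qed

section \<open>Zeros of damped second-order equations\<close>

text \<open>
  The regularity of a classical solution: one-sided differentiability at \<open>0\<close>, and a second
  derivative \<open>ddy\<close> that exists only for positive times and need not be continuous.
\<close>

locale C2_half_line =
  fixes y dy ddy :: "real \<Rightarrow> real"
  assumes deriv0: "t \<ge> 0 \<Longrightarrow> (y has_real_derivative dy t) (at t within {0..})"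
    and cont_dy: "continuous_on {0..} dy"
    and deriv2: "t > 0 \<Longrightarrow> (dy has_real_derivative ddy t) (at t)"
begin

lemma deriv1: "t > 0 \<Longrightarrow> (y has_real_derivative dy t) (at t)"
  using deriv0[of t] at_within_interior[of t "{0..}"] by simp

lemma cont_y: "continuous_on {0..} y"
  by (rule DERIV_continuous_on) (use deriv0 in auto)

text \<open>
  Rolle's theorem gives two zeros of \<open>dy\<close>, and the derivative of \<open>exp (t / m) * dy t\<close> is a positive
  multiple of \<open>m * ddy t + dy t\<close>.
\<close>

lemma three_equal_values_imp_damping_zero:
  assumes "0 \<le> a" "a < b" "b < c" "y a = y b" "y b = y c" "m > 0"
  shows "\<exists>r\<in>{a<..<c}. m * ddy r + dy r = 0"
proof -
  have rolle: "\<exists>z\<in>{p<..<q}. dy z = 0" if pq: "0 \<le> p" "p < q" "y p = y q" for p q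
  proof -
    have "\<exists>z>p. z < q \<and> (y has_real_derivative 0) (at z)"
    proof (rule Rolle)
      show "continuous_on {p..q} y" using pq by (intro continuous_on_subset[OF cont_y]) auto
      show "y differentiable at x" if "p < x" for x
        using deriv1[of x] that pq unfolding real_differentiable_def by auto
    qed (use pq in auto)
    then obtain z where z: "p < z" "z < q" "(y has_real_derivative 0) (at z)" by blast
    then have "dy z = 0" using DERIV_unique[OF deriv1 z(3)] pq by simp
    then show ?thesis using z by auto
  qed
  obtain s where s: "s \<in> {a<..<b}" "dy s = 0" using rolle[of a b] assms by auto
  obtain u where u: "u \<in> {b<..<c}" "dy u = 0" using rolle[of b c] assms by auto
  define E where "E = (\<lambda>t. exp (t / m) * dy t)"
  have dE: "(E has_real_derivative exp (t / m) * (m * ddy t + dy t) / m) (at t)" if "t > 0" for t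
  proof -
    have "(E has_real_derivative exp (t / m) * (1 / m) * dy t + exp (t / m) * ddy t) (at t)"
      unfolding E_def using assms by (auto intro!: derivative_eq_intros deriv2 that)
    moreover have "exp (t / m) * (1 / m) * dy t + exp (t / m) * ddy t
        = exp (t / m) * (m * ddy t + dy t) / m"
      using assms by (simp add: field_simps)
    ultimately show ?thesis by simp
  qed
  have "\<exists>r>s. r < u \<and> (E has_real_derivative 0) (at r)"
  proof (rule Rolle)
    show "continuous_on {s..u} E"
      by (rule DERIV_continuous_on, rule has_field_derivative_at_within, rule dE) (use s assms in auto)
    show "E differentiable at x" if "s < x" for x
      using dE[of x] that s assms unfolding real_differentiable_def by auto
  qed (use s u in \<open>auto simp: E_def\<close>)
  then obtain r where r: "s < r" "r < u" "(E has_real_derivative 0) (at r)" by blast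
  then have "exp (r / m) * (m * ddy r + dy r) / m = 0"
    using DERIV_unique[OF dE r(3)] s assms by auto
  then show ?thesis using r s u assms by (intro bexI[of _ r]) auto
qed

lemma infinite_equal_values_imp_damping_zero:
  assumes inf: "infinite S" and S: "S \<subseteq> {l..u}" "0 \<le> l" and val: "\<And>t. t \<in> S \<Longrightarrow> y t = v"
    and m: "m > 0"
  shows "\<exists>r\<in>{l<..<u}. m * ddy r + dy r = 0"
proof -
  obtain B where B: "card B = 3" "B \<subseteq> S"
    using infinite_arbitrarily_large[OF inf, of 3] by blast
  then obtain p q r where pqr: "B = {p, q, r}" "p \<noteq> q" "q \<noteq> r" "p \<noteq> r" by (auto simp: card_3_iff)
  obtain a b c where abc: "a \<in> B" "b \<in> B" "c \<in> B" "a < b" "b < c"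
    unfolding pqr(1) using pqr(2-4) by (metis insertI1 insertI2 linorder_less_linear)
  have "a \<in> {l..u}" "c \<in> {l..u}" "y a = v" "y b = v" "y c = v"
    using abc B(2) S(1) val by blast+
  moreover from this obtain r where "r \<in> {a<..<c}" "m * ddy r + dy r = 0"
    using three_equal_values_imp_damping_zero[of a b c m] abc S(2) m by auto
  ultimately show ?thesis by (intro bexI[of _ r]) auto
qed

lemma unbounded_equal_values_imp_zero_forcing:
  assumes freq: "\<exists>\<^sub>F t in at_top. y t = v" and m: "m > 0"
    and lim: "((\<lambda>t. m * ddy t + dy t) \<longlongrightarrow> D) at_top"
  shows "D = 0"
proof (rule ccontr)
  assume "D \<noteq> 0"
  then have "\<forall>\<^sub>F t in at_top. m * ddy t + dy t \<noteq> 0"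
    using tendsto_imp_eventually_ne[OF lim] by blast
  then obtain T where T: "\<And>t. t \<ge> T \<Longrightarrow> m * ddy t + dy t \<noteq> 0"
    unfolding eventually_at_top_linorder by blast
  have next_zero: "\<exists>t\<ge>S. y t = v" for S using freq unfolding frequently_at_top_real by blast
  obtain a where a: "a \<ge> max 0 T" "y a = v" using next_zero by blast
  obtain b where b: "b \<ge> a + 1" "y b = v" using next_zero by blast
  obtain c where c: "c \<ge> b + 1" "y c = v" using next_zero by blast
  obtain r where "r \<in> {a<..<c}" "m * ddy r + dy r = 0"
    using three_equal_values_imp_damping_zero[of a b c m] a b c m by auto
  then show False using T[of r] a by auto
qed

text \<open>
  The zeros that accumulate at \<open>t0\<close> yield \<open>dy t0 = 0\<close>, and, through zeros of \<open>m * ddy + dy\<close> close to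
  \<open>t0\<close>, also \<open>D = 0\<close>. What remains is uniqueness for the homogeneous equation, by Gronwall's argument for
  \<open>y\<^sup>2 + dy\<^sup>2\<close> forwards and backwards in time. This is the substitute for analyticity.
\<close>

lemma accumulating_zeros_imp_vanishing:
  assumes m: "m > 0" and t0: "t0 \<ge> 0" "t0 islimpt {t. t \<ge> 0 \<and> y t = 0}"
    and ode: "\<And>t. t > 0 \<Longrightarrow> \<bar>m * ddy t + dy t - D\<bar> \<le> M * \<bar>y t\<bar>"
    and t: "t \<ge> 0"
  shows "y t = 0"
proof -
  define S where "S = {t. t \<ge> 0 \<and> y t = 0}"
  have M: "M * \<bar>y t\<bar> \<ge> 0" if "t > 0" for t using ode[OF that] by linarith
  have lp: "t0 islimpt S" using t0 unfolding S_def by simp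
  have "closed S"
    using continuous_closed_preimage_constant[OF cont_y, of 0] by (auto simp: S_def vimage_def Int_def)
  then have y0: "y t0 = 0" using lp unfolding closed_limpt S_def by blast
  have nb: "at t0 within S \<noteq> bot" using lp by (simp add: trivial_limit_within)
  have dy0: "dy t0 = 0"
  proof -
    have "(y has_real_derivative dy t0) (at t0 within S)"
      using deriv0[OF t0(1)] by (rule DERIV_subset) (auto simp: S_def)
    then have "((\<lambda>s. (y s - y t0) / (s - t0)) \<longlongrightarrow> dy t0) (at t0 within S)"
      by (simp add: has_field_derivative_iff)
    moreover have "((\<lambda>s. (y s - y t0) / (s - t0)) \<longlongrightarrow> 0) (at t0 within S)"
      by (rule Lim_transform_eventually[OF tendsto_const])
        (auto simp: eventually_at_filter S_def y0)
    ultimately show ?thesis using tendsto_unique[OF nb] by blast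
  qed
  have D: "D = 0"
  proof (rule ccontr)
    assume "D \<noteq> 0"
    then have "\<bar>D\<bar> > 0" by simp
    moreover have "continuous_on {0..} (\<lambda>t. M * \<bar>y t\<bar>)" by (intro continuous_intros cont_y)
    ultimately obtain d where d: "d > 0"
      "\<And>t. t \<in> {0..} \<Longrightarrow> dist t t0 < d \<Longrightarrow> dist (M * \<bar>y t\<bar>) (M * \<bar>y t0\<bar>) < \<bar>D\<bar>"
      using t0(1) unfolding continuous_on_iff by (metis atLeast_iff)
    have "infinite (S \<inter> ball t0 d)" using lp d(1) by (simp add: islimpt_eq_infinite_ball)
    moreover have "S \<inter> ball t0 d \<subseteq> {max 0 (t0 - d)..t0 + d}" by (auto simp: S_def dist_real_def)
    ultimately have "\<exists>r\<in>{max 0 (t0 - d)<..<t0 + d}. m * ddy r + dy r = 0"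
      by (rule infinite_equal_values_imp_damping_zero[where v = 0]) (auto simp: S_def m)
    then obtain r where r: "r \<in> {max 0 (t0 - d)<..<t0 + d}" "m * ddy r + dy r = 0" by blast
    then have "\<bar>D\<bar> \<le> M * \<bar>y r\<bar>" using ode[of r] by simp
    then show False using r d(2)[of r] y0 by (simp add: dist_real_def abs_less_iff)
  qed
  define e where "e = (\<lambda>t. (y t)\<^sup>2 + (dy t)\<^sup>2)"
  define de where "de = (\<lambda>t. 2 * y t * dy t + 2 * dy t * ddy t)"
  define C where "C = 1 + \<bar>M\<bar> / m + 2 / m"
  have de: "(e has_real_derivative de t) (at t)" if "t > 0" for t
    unfolding e_def de_def by (auto intro!: derivative_eq_intros deriv1 deriv2 that)
  have ce: "continuous_on {0..} e"
    unfolding e_def by (intro continuous_intros cont_y cont_dy)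
  have bound: "\<bar>de t\<bar> \<le> C * e t" if "t > 0" for t
  proof -
    have "m * \<bar>ddy t\<bar> \<le> \<bar>M\<bar> * \<bar>y t\<bar> + \<bar>dy t\<bar>"
    proof -
      have "m * \<bar>ddy t\<bar> = \<bar>m * ddy t\<bar>" using m by (simp add: abs_mult)
      moreover have "M * \<bar>y t\<bar> \<le> \<bar>M\<bar> * \<bar>y t\<bar>" by (intro mult_right_mono) auto
      ultimately show ?thesis using ode[OF that] D by linarith
    qed
    then have dd: "\<bar>ddy t\<bar> \<le> \<bar>M\<bar> / m * \<bar>y t\<bar> + \<bar>dy t\<bar> / m" using m by (simp add: field_simps)
    have amgm: "2 * (\<bar>y t\<bar> * \<bar>dy t\<bar>) \<le> e t"
      using sum_squares_bound[of "\<bar>y t\<bar>" "\<bar>dy t\<bar>"] unfolding e_def by (simp add: algebra_simps)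
    have "\<bar>de t\<bar> \<le> 2 * (\<bar>y t\<bar> * \<bar>dy t\<bar>) + 2 * \<bar>dy t\<bar> * \<bar>ddy t\<bar>"
      unfolding de_def by (rule order_trans[OF abs_triangle_ineq]) (simp add: abs_mult)
    also have "\<dots> \<le> 2 * (\<bar>y t\<bar> * \<bar>dy t\<bar>) + 2 * \<bar>dy t\<bar> * (\<bar>M\<bar> / m * \<bar>y t\<bar> + \<bar>dy t\<bar> / m)"
      by (intro add_left_mono mult_left_mono dd) auto
    also have "\<dots> = (1 + \<bar>M\<bar> / m) * (2 * (\<bar>y t\<bar> * \<bar>dy t\<bar>)) + 2 / m * (dy t)\<^sup>2"
      using m by (simp add: field_simps power2_eq_square)
    also have "\<dots> \<le> (1 + \<bar>M\<bar> / m) * e t + 2 / m * e t"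
      using m by (intro add_mono mult_left_mono amgm) (auto simp: e_def)
    finally show ?thesis unfolding C_def by (simp add: algebra_simps)
  qed
  have e0: "e t0 = 0" using y0 dy0 by (simp add: e_def)
  have "e t \<le> 0"
  proof (cases "t0 \<le> t")
    case True
    have "exp (- C * t) * e t \<le> exp (- C * t0) * e t0"
    proof (rule DERIV_nonpos_imp_decreasing_open[OF True])
      fix x assume "t0 < x" "x < t"
      then have x: "x > 0" using t0 by simp
      have "((\<lambda>t. exp (- C * t) * e t) has_real_derivative exp (- C * x) * (de x - C * e x)) (at x)"
        by (auto intro!: derivative_eq_intros de x simp: algebra_simps)
      moreover have "exp (- C * x) * (de x - C * e x) \<le> 0"
        using bound[OF x] by (intro mult_nonneg_nonpos) auto
      ultimately show "\<exists>y. ((\<lambda>t. exp (- C * t) * e t) has_real_derivative y) (at x) \<and> y \<le> 0" by blast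
    next
      show "continuous_on {t0..t} (\<lambda>t. exp (- C * t) * e t)"
        by (intro continuous_intros continuous_on_subset[OF ce]) (use t0 in auto)
    qed
    then show ?thesis using e0 by (simp add: mult_le_0_iff)
  next
    case False
    then have le: "t \<le> t0" by simp
    have "exp (C * t) * e t \<le> exp (C * t0) * e t0"
    proof (rule DERIV_nonneg_imp_increasing_open[OF le])
      fix x assume "t < x" "x < t0"
      then have x: "x > 0" using t by simp
      have "((\<lambda>t. exp (C * t) * e t) has_real_derivative exp (C * x) * (de x + C * e x)) (at x)"
        by (auto intro!: derivative_eq_intros de x simp: algebra_simps)
      moreover have "exp (C * x) * (de x + C * e x) \<ge> 0"
        using bound[OF x] by (intro mult_nonneg_nonneg) auto
      ultimately show "\<exists>y. ((\<lambda>t. exp (C * t) * e t) has_real_derivative y) (at x) \<and> 0 \<le> y" by blast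
    next
      show "continuous_on {t..t0} (\<lambda>t. exp (C * t) * e t)"
        by (intro continuous_intros continuous_on_subset[OF ce]) (use t in auto)
    qed
    then show ?thesis using e0 by (simp add: mult_le_0_iff)
  qed
  then show "y t = 0" unfolding e_def by (simp add: sum_power2_le_zero_iff)
qed

text \<open>
  With \<open>z = exp (t / (2 * m)) * y\<close> the hypothesis says \<open>z * z'' \<ge> 0\<close>, so \<open>z * z'\<close> is nondecreasing.
  It vanishes at \<open>a\<close> and \<open>b\<close>, hence in between, where \<open>z\<^sup>2\<close> is therefore constant.
  In the proof \<open>w = z * z'\<close> and \<open>q = z\<^sup>2\<close>.
\<close>

lemma overdamped_zero_between_zeros:
  assumes m: "m > 0" and T: "T \<ge> 0"
    and ode: "\<And>t. t > T \<Longrightarrow> (m * ddy t + dy t) * y t \<ge> - (y t)\<^sup>2 / (4 * m)"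
    and ab: "T < a" "y a = 0" "y b = 0" and t: "a \<le> t" "t \<le> b"
  shows "y t = 0"
proof -
  define w where "w = (\<lambda>t. exp (t / m) * (y t * (dy t + y t / (2 * m))))"
  have pos: "s > 0" if "a \<le> s" for s using that ab T by simp
  have dw: "(w has_real_derivative exp (s / m) *
      ((dy s + y s / (2 * m))\<^sup>2 + ((m * ddy s + dy s) * y s + (y s)\<^sup>2 / (4 * m)) / m)) (at s)"
    if "a \<le> s" for s
  proof -
    have "(w has_real_derivative exp (s / m) * (1 / m) * (y s * (dy s + y s / (2 * m)))
        + exp (s / m) * (dy s * (dy s + y s / (2 * m)) + y s * (ddy s + dy s / (2 * m)))) (at s)"
      unfolding w_def using m that by (auto intro!: derivative_eq_intros deriv1 deriv2 pos)
    moreover have "exp (s / m) * (1 / m) * (y s * (dy s + y s / (2 * m)))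
        + exp (s / m) * (dy s * (dy s + y s / (2 * m)) + y s * (ddy s + dy s / (2 * m)))
      = exp (s / m) *
      ((dy s + y s / (2 * m))\<^sup>2 + ((m * ddy s + dy s) * y s + (y s)\<^sup>2 / (4 * m)) / m)"
      using m by (simp add: field_simps power2_eq_square)
    ultimately show ?thesis by simp
  qed
  have mono: "w s \<le> w u" if su: "a \<le> s" "s \<le> u" for s u
  proof (rule DERIV_nonneg_imp_nondecreasing[OF su(2)])
    fix x assume "s \<le> x" "x \<le> u"
    then have x: "a \<le> x" using su by simp
    have "0 \<le> (m * ddy x + dy x) * y x + (y x)\<^sup>2 / (4 * m)" using ode[of x] x ab by simp
    then have "0 \<le> exp (x / m) *
      ((dy x + y x / (2 * m))\<^sup>2 + ((m * ddy x + dy x) * y x + (y x)\<^sup>2 / (4 * m)) / m)"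
      using m by simp
    then show "\<exists>z. (w has_real_derivative z) (at x) \<and> 0 \<le> z" using dw[OF x] by blast
  qed
  have w0: "w s = 0" if "a \<le> s" "s \<le> b" for s
    using mono[of a s] mono[of s b] that ab unfolding w_def by auto
  define q where "q = (\<lambda>t. exp (t / m) * (y t)\<^sup>2)"
  have dq: "(q has_real_derivative 0) (at s)" if "a \<le> s" "s \<le> b" for s
  proof -
    have "(q has_real_derivative 2 * w s) (at s)"
    proof -
      have "(q has_real_derivative exp (s / m) * (1 / m) * (y s)\<^sup>2
          + exp (s / m) * (2 * y s * dy s)) (at s)"
        unfolding q_def using m that by (auto intro!: derivative_eq_intros deriv1 pos)
      moreover have "exp (s / m) * (1 / m) * (y s)\<^sup>2 + exp (s / m) * (2 * y s * dy s) = 2 * w s"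
        unfolding w_def using m by (simp add: field_simps power2_eq_square)
      ultimately show ?thesis by simp
    qed
    then show ?thesis using w0[OF that] by simp
  qed
  have "q t = q a"
  proof (cases "a = b")
    case False
    then have "a < b" using t by simp
    then show ?thesis
    proof (rule DERIV_isconst2)
      show "continuous_on {a..b} q"
        by (rule DERIV_continuous_on, rule has_field_derivative_at_within, rule dq) auto
    qed (use dq t in auto)
  qed (use t in simp)
  then show ?thesis using ab by (simp add: q_def)
qed

end

section \<open>Coincidences of two oscillators\<close>

lemma rcong_2pi_iff_sin: "[a = b] (rmod (2 * pi)) \<longleftrightarrow> sin ((a - b) / 2) = 0"
proof -
  have "[a = b] (rmod (2 * pi)) \<longleftrightarrow> (\<exists>k::int. a = b + of_int k * (2 * pi))"
    using rcong_altdef[of b a] rcong_sym_iff by blast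
  also have "\<dots> \<longleftrightarrow> (\<exists>k::int. (a - b) / 2 = of_int k * pi)"
    by (rule ex_cong1) (auto simp: field_simps)
  finally show ?thesis by (simp add: sin_zero_iff_int2)
qed

lemma abs_cos_of_int_pi: "\<bar>cos (of_int k * pi)\<bar> = 1"
  by (rule sin_zero_abs_cos_one) (auto simp: sin_zero_iff_int2)

lemma sin_add_of_int_pi: "sin (x + of_int k * pi) = cos (of_int k * pi) * sin x"
  and cos_add_of_int_pi: "cos (x + of_int k * pi) = cos (of_int k * pi) * cos x"
proof -
  have "sin (of_int k * pi) = 0" by (auto simp: sin_zero_iff_int2)
  then show "sin (x + of_int k * pi) = cos (of_int k * pi) * sin x"
    "cos (x + of_int k * pi) = cos (of_int k * pi) * cos x"
    by (simp_all add: sin_add cos_add)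
qed

lemma not_isolated_half_line: "\<not> (t::real) isolated_in {0..}"
proof -
  have "t islimpt {0..}" if "t \<ge> 0"
  proof -
    have "t islimpt {t<..<t+1}" by (rule islimpt_greaterThanLessThan1) simp
    then show ?thesis by (rule islimpt_subset) (use that in auto)
  qed
  then show ?thesis by (auto simp: isolated_in_islimpt_iff)
qed

locale kuramoto_path =
  fixes N :: nat and m \<kappa> :: real and \<nu> :: "nat \<Rightarrow> real" and \<theta> \<omega> \<alpha> :: "nat \<Rightarrow> real \<Rightarrow> real"
  assumes N: "N \<ge> 1" and m: "m > 0" and \<kappa>: "\<kappa> \<ge> 0"
    and C2: "i \<in> {1..N} \<Longrightarrow> C2_half_line (\<theta> i) (\<omega> i) (\<alpha> i)"
    and ode: "i \<in> {1..N} \<Longrightarrow> t > 0 \<Longrightarrow>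
      m * \<alpha> i t + \<omega> i t = \<nu> i + \<kappa> / real N * (\<Sum>j=1..N. sin (\<theta> j t - \<theta> i t))"
begin

lemma C2_diff:
  assumes "i \<in> {1..N}" "j \<in> {1..N}"
  shows "C2_half_line (\<lambda>t. \<theta> i t - \<theta> j t - c) (\<lambda>t. \<omega> i t - \<omega> j t) (\<lambda>t. \<alpha> i t - \<alpha> j t)"
proof -
  interpret i: C2_half_line "\<theta> i" "\<omega> i" "\<alpha> i" by (rule C2) fact
  interpret j: C2_half_line "\<theta> j" "\<omega> j" "\<alpha> j" by (rule C2) fact
  show ?thesis
    by unfold_locales
      (auto intro!: derivative_eq_intros continuous_intros i.deriv0 j.deriv0 i.cont_dy j.cont_dy
        i.deriv2 j.deriv2)
qed

lemma cont_diff: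
  assumes "i \<in> {1..N}" "j \<in> {1..N}"
  shows "continuous_on {0..} (\<lambda>t. \<theta> i t - \<theta> j t)"
  using C2_half_line.cont_y[OF C2_diff[OF assms, of 0]] by simp

text \<open>
  The coefficient \<open>c(t)\<close> in the equation for a phase difference: the sum-to-product formula for
  \<open>sin (\<theta> l - \<theta> i) - sin (\<theta> l - \<theta> j)\<close> produces the phases relative to the midpoint of \<open>\<theta> i\<close> and
  \<open>\<theta> j\<close>.
\<close>

definition midpoint_cos :: "nat \<Rightarrow> nat \<Rightarrow> real \<Rightarrow> real" where
  "midpoint_cos i j t = 1 / real N * (\<Sum>l=1..N. cos (\<theta> l t - (\<theta> i t + \<theta> j t) / 2))"

lemma abs_midpoint_cos_le: "\<bar>midpoint_cos i j t\<bar> \<le> 1"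
proof -
  have "\<bar>\<Sum>l=1..N. cos (\<theta> l t - (\<theta> i t + \<theta> j t) / 2)\<bar> \<le> (\<Sum>l=1..N. 1)"
    by (rule order_trans[OF sum_abs]) (intro sum_mono, simp)
  then show ?thesis using N unfolding midpoint_cos_def by (simp add: abs_mult field_simps)
qed

lemma pair_ode:
  assumes "i \<in> {1..N}" "j \<in> {1..N}" "t > 0"
  shows "m * (\<alpha> i t - \<alpha> j t) + (\<omega> i t - \<omega> j t) =
    \<nu> i - \<nu> j - 2 * \<kappa> * sin ((\<theta> i t - \<theta> j t) / 2) * midpoint_cos i j t"
proof -
  have s: "sin (\<theta> l t - \<theta> i t) - sin (\<theta> l t - \<theta> j t) =
    - 2 * sin ((\<theta> i t - \<theta> j t) / 2) * cos (\<theta> l t - (\<theta> i t + \<theta> j t) / 2)" for l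
  proof -
    have "(\<theta> l t - \<theta> i t - (\<theta> l t - \<theta> j t)) / 2 = - ((\<theta> i t - \<theta> j t) / 2)"
      "(\<theta> l t - \<theta> i t + (\<theta> l t - \<theta> j t)) / 2 = \<theta> l t - (\<theta> i t + \<theta> j t) / 2"
      by (simp_all add: field_simps)
    then show ?thesis by (simp only: sin_diff_sin sin_minus)
  qed
  have "m * (\<alpha> i t - \<alpha> j t) + (\<omega> i t - \<omega> j t) = (m * \<alpha> i t + \<omega> i t) - (m * \<alpha> j t + \<omega> j t)"
    by (simp add: algebra_simps)
  also have "\<dots> = \<nu> i - \<nu> j
      + \<kappa> / real N * (\<Sum>l=1..N. sin (\<theta> l t - \<theta> i t) - sin (\<theta> l t - \<theta> j t))"
    using ode assms by (simp add: sum_subtractf algebra_simps)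
  also have "(\<Sum>l=1..N. sin (\<theta> l t - \<theta> i t) - sin (\<theta> l t - \<theta> j t)) =
      - 2 * sin ((\<theta> i t - \<theta> j t) / 2) * (\<Sum>l=1..N. cos (\<theta> l t - (\<theta> i t + \<theta> j t) / 2))"
    by (simp only: s sum_distrib_left)
  finally show ?thesis unfolding midpoint_cos_def by simp
qed

abbreviation coincidences :: "nat \<Rightarrow> nat \<Rightarrow> real set" where
  "coincidences i j \<equiv> {t. t \<ge> 0 \<and> [\<theta> i t = \<theta> j t] (rmod (2 * pi))}"

lemma accumulating_coincidences_imp_constant_difference:
  assumes ij: "i \<in> {1..N}" "j \<in> {1..N}" and t0: "t0 \<ge> 0" "t0 islimpt coincidences i j"
  shows "\<exists>k::int. \<forall>t\<ge>0. \<theta> i t - \<theta> j t = 2 * pi * of_int k"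
proof -
  define x where "x = (\<lambda>t. \<theta> i t - \<theta> j t)"
  have cx: "continuous_on {0..} x" unfolding x_def by (rule cont_diff[OF ij])
  have A: "coincidences i j = {t \<in> {0..}. sin (x t / 2) = 0}"
    by (auto simp: rcong_2pi_iff_sin x_def)
  have "closed (coincidences i j)"
    unfolding A by (intro continuous_closed_preimage_constant continuous_intros cx) auto
  then have "t0 \<in> coincidences i j" using t0(2) unfolding closed_limpt by blast
  then have "sin (x t0 / 2) = 0" unfolding A by simp
  then obtain k :: int where k: "x t0 / 2 = of_int k * pi" unfolding sin_zero_iff_int2 by blast
  define y where "y = (\<lambda>t. \<theta> i t - \<theta> j t - 2 * pi * of_int k)"
  interpret C2_half_line y "\<lambda>t. \<omega> i t - \<omega> j t" "\<lambda>t. \<alpha> i t - \<alpha> j t"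
    unfolding y_def by (rule C2_diff[OF ij])
  have xy: "x t = y t + of_int k * (2 * pi)" for t unfolding x_def y_def by simp
  have y0: "y t0 = 0" using k xy[of t0] by simp
  obtain d where d: "d > 0" "\<And>t. t \<in> {0..} \<Longrightarrow> dist t t0 < d \<Longrightarrow> dist (y t) (y t0) < 2 * pi"
    using cont_y t0(1) unfolding continuous_on_iff by (metis atLeast_iff pi_gt_zero mult_pos_pos zero_less_numeral)
  have near: "y t = 0" if "t \<in> coincidences i j" "dist t t0 < d" for t
  proof -
    have t: "t \<ge> 0" "[\<theta> i t = \<theta> j t] (rmod (2 * pi))" using that by auto
    have "\<bar>y t\<bar> < 2 * pi" using d(2)[of t] that t(1) y0 by (simp add: dist_real_def)
    moreover have "[\<theta> i t - of_int k * (2 * pi) = \<theta> j t] (rmod (2 * pi))"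
      using rcong_diff[OF t(2) rcong_mult_of_int_0_left_right[of k "2 * pi"]] by simp
    ultimately show ?thesis
      using rcong_imp_eq[of "\<theta> i t - of_int k * (2 * pi)" "\<theta> j t" "2 * pi"]
      by (simp add: y_def algebra_simps)
  qed
  have lp: "t0 islimpt {t. t \<ge> 0 \<and> y t = 0}"
    unfolding islimpt_approachable
  proof (intro allI impI)
    fix e :: real assume "e > 0"
    then have "0 < min d e" using d(1) by simp
    then obtain t where t: "t \<in> coincidences i j" "t \<noteq> t0" "dist t t0 < min d e"
      using t0(2) unfolding islimpt_approachable by blast
    then have "y t = 0" using near by simp
    then show "\<exists>x'\<in>{t. t \<ge> 0 \<and> y t = 0}. x' \<noteq> t0 \<and> dist x' t0 < e"
      using t by (intro bexI[of _ t]) auto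
  qed
  have "y t = 0" if "t \<ge> 0" for t
  proof (rule accumulating_zeros_imp_vanishing[OF m t0(1) lp _ that])
    fix t :: real assume t: "t > 0"
    have half: "x t / 2 = y t / 2 + of_int k * pi" using xy[of t] by (simp add: field_simps)
    have "\<bar>sin (x t / 2)\<bar> = \<bar>sin (y t / 2)\<bar>"
      unfolding half sin_add_of_int_pi by (simp add: abs_mult abs_cos_of_int_pi)
    also have "\<dots> \<le> \<bar>y t\<bar> / 2" using abs_sin_x_le_abs_x[of "y t / 2"] by simp
    finally have s: "\<bar>sin (x t / 2)\<bar> \<le> \<bar>y t\<bar> / 2" .
    have "\<bar>2 * \<kappa> * sin (x t / 2) * midpoint_cos i j t\<bar>
        = 2 * \<kappa> * (\<bar>sin (x t / 2)\<bar> * \<bar>midpoint_cos i j t\<bar>)" using \<kappa> by (simp add: abs_mult)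
    also have "\<dots> \<le> 2 * \<kappa> * (\<bar>y t\<bar> / 2 * 1)"
      using \<kappa> s abs_midpoint_cos_le by (intro mult_left_mono mult_mono) auto
    finally show "\<bar>m * (\<alpha> i t - \<alpha> j t) + (\<omega> i t - \<omega> j t) - (\<nu> i - \<nu> j)\<bar> \<le> \<kappa> * \<bar>y t\<bar>"
      using pair_ode[OF ij t] by (simp add: x_def)
  qed
  then show ?thesis unfolding y_def by (intro exI[of _ k]) auto
qed

text \<open>
  Infinitely many would accumulate, and then coincidences fill the whole half-line, leaving none isolated.
\<close>

lemma finite_collisions_before:
  assumes ij: "i \<in> {1..N}" "j \<in> {1..N}"
  shows "finite {t. collide_at \<theta> i j t \<and> t \<le> T}"
proof (rule ccontr)
  assume inf: "infinite {t. collide_at \<theta> i j t \<and> t \<le> T}"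
  have sub: "{t. collide_at \<theta> i j t \<and> t \<le> T} \<subseteq> coincidences i j \<inter> {0..T}"
    by (auto simp: collide_at_def isolated_in_islimpt_iff)
  then obtain t0 where t0: "t0 \<in> {0..T}" "t0 islimpt {t. collide_at \<theta> i j t \<and> t \<le> T}"
    using Heine_Borel_imp_Bolzano_Weierstrass[OF compact_Icc inf, of 0 T] by blast
  then have "t0 islimpt coincidences i j" using sub islimpt_subset by blast
  then obtain k :: int where k: "\<forall>t\<ge>0. \<theta> i t - \<theta> j t = 2 * pi * of_int k"
    using accumulating_coincidences_imp_constant_difference[OF ij, of t0] t0 by auto
  have "coincidences i j = {0..}" using k by (auto simp: rcong_2pi_iff_sin)
  then have "{t. collide_at \<theta> i j t \<and> t \<le> T} = {}"
    using not_isolated_half_line by (simp add: collide_at_def)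
  then show False using inf by (metis finite.emptyI)
qed

text \<open>
  If no coincidences accumulate, every coincidence is a collision; after the last one the continuous
  difference cannot leave the interval between consecutive multiples of \<open>2 * pi\<close> that contains it.
\<close>

lemma bounded_difference_if_finite_collisions:
  assumes ij: "i \<in> {1..N}" "j \<in> {1..N}" and fin: "finite {t. collide_at \<theta> i j t}"
  shows "\<exists>B. \<forall>t\<ge>0. \<bar>\<theta> i t - \<theta> j t\<bar> \<le> B"
proof (cases "\<exists>t0\<ge>0. t0 islimpt coincidences i j")
  case True
  then show ?thesis using accumulating_coincidences_imp_constant_difference[OF ij]
    by (metis order_refl)
next
  case False
  then have "{t. collide_at \<theta> i j t} = coincidences i j"
    by (auto simp: collide_at_def isolated_in_islimpt_iff)
  then have finA: "finite (coincidences i j)" using fin by simp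
  define T where "T = Max (insert 0 (coincidences i j)) + 1"
  have T: "T > t" if "t \<in> insert 0 (coincidences i j)" for t
    using Max_ge[OF _ that] finA unfolding T_def by fastforce
  then have T0: "T > 0" by simp
  define x where "x = (\<lambda>t. \<theta> i t - \<theta> j t)"
  have cx: "continuous_on {0..} x" unfolding x_def by (rule cont_diff[OF ij])
  have avoid: "x t \<noteq> 2 * pi * of_int k" if "t \<ge> T" for t and k :: int
  proof
    assume "x t = 2 * pi * of_int k"
    then have "t \<in> coincidences i j" using that T0 by (simp add: rcong_2pi_iff_sin x_def)
    then show False using T[of t] that by simp
  qed
  define k where "k = \<lfloor>x T / (2 * pi)\<rfloor>"
  have k: "2 * pi * of_int k \<le> x T" "x T \<le> 2 * pi * of_int (k + 1)"
    unfolding k_def using floor_divide_lower[of "2 * pi" "x T"] floor_divide_upper[of "2 * pi" "x T"]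
    by (auto simp: algebra_simps)
  have between: "2 * pi * of_int k \<le> x t \<and> x t \<le> 2 * pi * of_int (k + 1)" if t: "t \<ge> T" for t
  proof -
    have c: "continuous_on {T..t} x" by (rule continuous_on_subset[OF cx]) (use T0 in auto)
    have "\<not> x t > 2 * pi * of_int (k + 1)"
      using IVT'[of x T "2 * pi * of_int (k + 1)" t] k t c avoid by (metis less_imp_le)
    moreover have "\<not> x t < 2 * pi * of_int k"
      using IVT2'[of x t "2 * pi * of_int k" T] k t c avoid by (metis less_imp_le)
    ultimately show ?thesis by simp
  qed
  have "bounded (x ` {0..T})"
    by (intro compact_imp_bounded compact_continuous_image continuous_on_subset[OF cx]) auto
  then obtain B where B: "\<And>t. t \<in> {0..T} \<Longrightarrow> \<bar>x t\<bar> \<le> B"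
    unfolding bounded_iff by (metis imageI real_norm_def)
  have "\<bar>x t\<bar> \<le> max B (max \<bar>2 * pi * of_int k\<bar> \<bar>2 * pi * of_int (k + 1)\<bar>)" if "t \<ge> 0" for t
    using B[of t] between[of t] that by (cases "t \<le> T") auto
  then show ?thesis unfolding x_def by blast
qed

end

section \<open>Collisions under phase locking\<close>

context kuramoto_path begin

lemma frequently_collide:
  assumes ij: "i \<in> {1..N}" "j \<in> {1..N}" and inf: "infinite {t. collide_at \<theta> i j t}"
  shows "\<exists>\<^sub>F t in at_top. collide_at \<theta> i j t"
  unfolding frequently_at_top_real
proof
  fix T
  have "{t. collide_at \<theta> i j t} \<noteq> {t. collide_at \<theta> i j t \<and> t \<le> T}"
    using inf finite_collisions_before[OF ij, of T] by metis
  then obtain t where "collide_at \<theta> i j t" "\<not> t \<le> T" by blast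
  then show "\<exists>t\<ge>T. collide_at \<theta> i j t" by (intro exI[of _ t]) auto
qed

text \<open>
  Collisions are isolated and finite in number up to any time, so infinitely many of them run to
  infinity. If the difference to its limit obeyed an overdamped equation from some time on, two late
  collisions would enclose an interval of coincidences, contradicting isolation.
\<close>

lemma infinite_collisions_at_phase_locking:
  assumes ij: "i \<in> {1..N}" "j \<in> {1..N}" and inf: "infinite {t. collide_at \<theta> i j t}"
    and lim: "((\<lambda>t. \<theta> i t - \<theta> j t) \<longlongrightarrow> L) at_top"
    and C: "((\<lambda>t. 1 / real N * (\<Sum>l=1..N. cos (\<theta> l t - \<theta> i t))) \<longlongrightarrow> C) at_top"
  shows "\<nu> i = \<nu> j" and "L \<in> two_pi_ints" and "m * \<kappa> > 1 / 4" and "m * \<kappa> * C \<ge> 1 / 4"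
proof -
  define x where "x = (\<lambda>t. \<theta> i t - \<theta> j t)"
  have limx: "(x \<longlongrightarrow> L) at_top" using lim unfolding x_def .
  have coll_sin: "sin (x t / 2) = 0" "t \<ge> 0" if "collide_at \<theta> i j t" for t
    using that unfolding collide_at_def isolated_in_islimpt_iff x_def by (auto simp: rcong_2pi_iff_sin)
  have lims: "((\<lambda>t. sin (x t / 2)) \<longlongrightarrow> sin (L / 2)) at_top" by (intro tendsto_intros limx) simp
  have "sin (L / 2) = 0"
  proof (rule ccontr)
    assume "sin (L / 2) \<noteq> 0"
    then have "\<forall>\<^sub>F t in at_top. sin (x t / 2) \<noteq> 0"
      using tendsto_imp_eventually_ne[OF lims] by blast
    then have "\<forall>\<^sub>F t in at_top. \<not> collide_at \<theta> i j t"
      by (rule eventually_mono) (use coll_sin in blast)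
    then show False using frequently_collide[OF ij inf] by (simp add: frequently_def)
  qed
  then obtain k :: int where k: "L / 2 = of_int k * pi" unfolding sin_zero_iff_int2 by blast
  then have L: "L = 2 * pi * of_int k" by simp
  then show "L \<in> two_pi_ints" unfolding two_pi_ints_def by blast
  define y where "y = (\<lambda>t. \<theta> i t - \<theta> j t - L)"
  interpret C2_half_line y "\<lambda>t. \<omega> i t - \<omega> j t" "\<lambda>t. \<alpha> i t - \<alpha> j t"
    unfolding y_def by (rule C2_diff[OF ij])
  have limy: "(y \<longlongrightarrow> 0) at_top"
    using tendsto_diff[OF lim tendsto_const[of L]] unfolding y_def by simp
  have small: "\<forall>\<^sub>F t in at_top. \<bar>y t\<bar> < 2 * pi"
    using tendstoD[OF limy, of "2 * pi"] by (simp add: dist_real_def)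
  have half: "x t / 2 = y t / 2 + of_int k * pi" for t
    unfolding x_def y_def L by (simp add: field_simps)
  have freq: "\<exists>\<^sub>F t in at_top. collide_at \<theta> i j t \<and> y t = 0"
  proof -
    have "\<exists>\<^sub>F t in at_top. collide_at \<theta> i j t \<and> \<bar>y t\<bar> < 2 * pi"
      by (rule frequently_eventually_frequently[OF frequently_collide[OF ij inf] small])
    then show ?thesis
    proof (rule frequently_elim1)
      fix t assume t: "collide_at \<theta> i j t \<and> \<bar>y t\<bar> < 2 * pi"
      have "[y t = 0] (rmod (2 * pi))"
        using coll_sin(1)[of t] t abs_cos_of_int_pi[of k]
        unfolding half sin_add_of_int_pi rcong_2pi_iff_sin by auto
      then have "y t = 0" using t by (intro rcong_imp_eq[of _ _ "2 * pi"]) auto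
      with t show "collide_at \<theta> i j t \<and> y t = 0" by blast
    qed
  qed
  show nu: "\<nu> i = \<nu> j"
  proof -
    have s0: "((\<lambda>t. 2 * \<kappa> * (sin (x t / 2) * midpoint_cos i j t)) \<longlongrightarrow> 2 * \<kappa> * 0) at_top"
    proof (intro tendsto_intros)
      show "((\<lambda>t. sin (x t / 2) * midpoint_cos i j t) \<longlongrightarrow> 0) at_top"
      proof (rule Lim_null_comparison)
        show "\<forall>\<^sub>F t in at_top. norm (sin (x t / 2) * midpoint_cos i j t) \<le> \<bar>sin (x t / 2)\<bar>"
          using abs_midpoint_cos_le by (auto simp: abs_mult mult_left_le)
        show "((\<lambda>t. \<bar>sin (x t / 2)\<bar>) \<longlongrightarrow> 0) at_top"
          using tendsto_rabs_zero lims \<open>sin (L / 2) = 0\<close> by simp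
      qed
    qed
    have "((\<lambda>t. \<nu> i - \<nu> j - 2 * \<kappa> * (sin (x t / 2) * midpoint_cos i j t)) \<longlongrightarrow> \<nu> i - \<nu> j - 2 * \<kappa> * 0) at_top"
      by (intro tendsto_diff tendsto_const s0)
    moreover have "\<forall>\<^sub>F t in at_top. \<nu> i - \<nu> j - 2 * \<kappa> * (sin (x t / 2) * midpoint_cos i j t)
        = m * (\<alpha> i t - \<alpha> j t) + (\<omega> i t - \<omega> j t)"
      using eventually_gt_at_top[of 0]
      by eventually_elim (use pair_ode[OF ij] in \<open>simp add: x_def mult.assoc\<close>)
    ultimately have "((\<lambda>t. m * (\<alpha> i t - \<alpha> j t) + (\<omega> i t - \<omega> j t)) \<longlongrightarrow> \<nu> i - \<nu> j - 2 * \<kappa> * 0) at_top"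
      by (rule Lim_transform_eventually)
    moreover have "\<exists>\<^sub>F t in at_top. y t = 0" by (rule frequently_elim1[OF freq]) simp
    ultimately show ?thesis using unbounded_equal_values_imp_zero_forcing[OF _ m, of 0] by fastforce
  qed
  define s where "s = cos (of_int k * pi)"
  have s: "\<bar>s\<bar> = 1" unfolding s_def by (rule abs_cos_of_int_pi)
  \<comment> \<open>The sign \<open>s\<close> turns \<open>midpoint_cos\<close>, which involves half of \<open>L\<close>, into a quantity with limit \<open>C\<close>.\<close>
  have damping: "(m * (\<alpha> i t - \<alpha> j t) + (\<omega> i t - \<omega> j t)) * y t =
      - (2 * \<kappa> * (sin (y t / 2) * y t) * (s * midpoint_cos i j t))" if "t > 0" for t
  proof -
    have "sin ((\<theta> i t - \<theta> j t) / 2) = s * sin (y t / 2)"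
      unfolding s_def by (simp only: half[unfolded x_def] sin_add_of_int_pi)
    then show ?thesis using pair_ode[OF ij that] nu by simp
  qed
  have sin_y: "\<bar>sin (y t / 2) * y t\<bar> \<le> (y t)\<^sup>2 / 2" for t
  proof -
    have "\<bar>sin (y t / 2)\<bar> * \<bar>y t\<bar> \<le> \<bar>y t / 2\<bar> * \<bar>y t\<bar>"
      by (intro mult_right_mono abs_sin_x_le_abs_x) auto
    also have "\<dots> = (y t)\<^sup>2 / 2" by (simp add: power2_eq_square)
    finally show ?thesis by (simp add: abs_mult)
  qed
  have not_overdamped: False
    if od: "\<forall>\<^sub>F t in at_top. 2 * \<kappa> * (sin (y t / 2) * y t) * (s * midpoint_cos i j t) \<le> (y t)\<^sup>2 / (4 * m)"
  proof -
    obtain T where T: "T \<ge> 0"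
      "\<And>t. t > T \<Longrightarrow> 2 * \<kappa> * (sin (y t / 2) * y t) * (s * midpoint_cos i j t) \<le> (y t)\<^sup>2 / (4 * m)"
    proof -
      obtain T where "\<And>t. t \<ge> T \<Longrightarrow>
        2 * \<kappa> * (sin (y t / 2) * y t) * (s * midpoint_cos i j t) \<le> (y t)\<^sup>2 / (4 * m)"
        using od unfolding eventually_at_top_linorder by blast
      then show ?thesis using that[of "max 0 T"] by simp
    qed
    obtain a where a: "a \<ge> T + 1" "collide_at \<theta> i j a" "y a = 0"
      using freq unfolding frequently_at_top_real by blast
    obtain b where b: "b \<ge> a + 1" "y b = 0"
      using freq unfolding frequently_at_top_real by blast
    have y0: "y t = 0" if "t \<in> {a..b}" for t
    proof (rule overdamped_zero_between_zeros[OF m T(1), of a b])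
      fix t assume t: "t > T"
      then show "(m * (\<alpha> i t - \<alpha> j t) + (\<omega> i t - \<omega> j t)) * y t \<ge> - (y t)\<^sup>2 / (4 * m)"
        using T(2)[OF t] damping[of t] T(1) by simp
    qed (use a b that in auto)
    have "{a<..<b} \<subseteq> coincidences i j"
    proof
      fix t assume t: "t \<in> {a<..<b}"
      then have "sin (x t / 2) = 0" unfolding half sin_add_of_int_pi using y0[of t] by simp
      then show "t \<in> coincidences i j" using t a T by (simp add: rcong_2pi_iff_sin x_def)
    qed
    moreover have "a islimpt {a<..<b}" using b by (intro islimpt_greaterThanLessThan1) simp
    ultimately have "a islimpt coincidences i j" using islimpt_subset by blast
    then show False using a(2) by (simp add: collide_at_def isolated_in_islimpt_iff)
  qed
  show c: "m * \<kappa> > 1 / 4"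
  proof (rule ccontr)
    assume "\<not> ?thesis"
    then have mk: "\<kappa> \<le> 1 / (4 * m)" using m by (simp add: field_simps)
    have "2 * \<kappa> * (sin (y t / 2) * y t) * (s * midpoint_cos i j t) \<le> (y t)\<^sup>2 / (4 * m)" for t
    proof -
      have "2 * \<kappa> * (sin (y t / 2) * y t) * (s * midpoint_cos i j t)
          \<le> \<bar>2 * \<kappa> * (sin (y t / 2) * y t) * (s * midpoint_cos i j t)\<bar>" by simp
      also have "\<dots> = 2 * \<kappa> * (\<bar>sin (y t / 2) * y t\<bar> * (\<bar>s\<bar> * \<bar>midpoint_cos i j t\<bar>))"
        using \<kappa> by (simp add: abs_mult)
      also have "\<dots> \<le> 2 * \<kappa> * ((y t)\<^sup>2 / 2 * (1 * 1))"
        using \<kappa> s sin_y abs_midpoint_cos_le by (intro mult_left_mono mult_mono) auto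
      also have "\<dots> = \<kappa> * (y t)\<^sup>2" by simp
      also have "\<dots> \<le> 1 / (4 * m) * (y t)\<^sup>2" using mk by (intro mult_right_mono) auto
      finally show ?thesis by simp
    qed
    then show False using not_overdamped by simp
  qed
  show "m * \<kappa> * C \<ge> 1 / 4"
  proof (rule ccontr)
    assume neg: "\<not> ?thesis"
    have mk: "m * \<kappa> > 0" using c by linarith
    then have kp: "\<kappa> > 0" using m by (simp add: zero_less_mult_iff)
    \<comment> \<open>The critical value of the cosine average, for which the linear equation is exactly
      critically damped.\<close>
    define C' where "C' = 1 / (4 * (m * \<kappa>))"
    have C': "C < C'" "C' > 0" using neg mk unfolding C'_def by (auto simp: field_simps)
    have mid: "((\<lambda>t. s * midpoint_cos i j t) \<longlongrightarrow> C) at_top"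
    proof -
      have l0: "((\<lambda>t. y t / 2) \<longlongrightarrow> 0) at_top" using tendsto_divide[OF limy tendsto_const[of 2]] by simp
      have eq: "s * cos (\<theta> l t - (\<theta> i t + \<theta> j t) / 2)
          = cos (\<theta> l t - \<theta> i t) * cos (y t / 2) - sin (\<theta> l t - \<theta> i t) * sin (y t / 2)" for l t
      proof -
        have "\<theta> l t - (\<theta> i t + \<theta> j t) / 2 = (\<theta> l t - \<theta> i t + y t / 2) + of_int k * pi"
          using half[of t] unfolding x_def by (simp add: field_simps)
        then have "cos (\<theta> l t - (\<theta> i t + \<theta> j t) / 2) = s * cos (\<theta> l t - \<theta> i t + y t / 2)"
          unfolding s_def by (simp only: cos_add_of_int_pi)
        moreover have "s * s = 1" using s by (metis abs_mult_self_eq mult_1)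
        ultimately show ?thesis by (simp add: cos_add flip: mult.assoc)
      qed
      have "s * midpoint_cos i j t = (1 / real N * (\<Sum>l=1..N. cos (\<theta> l t - \<theta> i t))) * cos (y t / 2)
          - (1 / real N * (\<Sum>l=1..N. sin (\<theta> l t - \<theta> i t))) * sin (y t / 2)" for t
      proof -
        have "s * midpoint_cos i j t = 1 / real N * (\<Sum>l=1..N. s * cos (\<theta> l t - (\<theta> i t + \<theta> j t) / 2))"
          unfolding midpoint_cos_def by (simp add: sum_distrib_left)
        then show ?thesis unfolding eq by (simp add: sum_subtractf diff_divide_distrib flip: sum_distrib_right)
      qed
      moreover have "((\<lambda>t. (1 / real N * (\<Sum>l=1..N. sin (\<theta> l t - \<theta> i t))) * sin (y t / 2)) \<longlongrightarrow> 0) at_top"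
      proof (rule Lim_null_comparison)
        have "\<bar>\<Sum>l=1..N. sin (\<theta> l t - \<theta> i t)\<bar> \<le> (\<Sum>l=1..N. 1)" for t
          by (rule order_trans[OF sum_abs]) (intro sum_mono, simp)
        then have "\<bar>1 / real N * (\<Sum>l=1..N. sin (\<theta> l t - \<theta> i t))\<bar> \<le> 1" for t
          using N by (simp add: abs_mult field_simps)
        then show "\<forall>\<^sub>F t in at_top. norm ((1 / real N * (\<Sum>l=1..N. sin (\<theta> l t - \<theta> i t))) * sin (y t / 2))
            \<le> \<bar>sin (y t / 2)\<bar>"
          unfolding real_norm_def abs_mult[of "1 / real N * _"]
          by (intro always_eventually allI mult_left_le_one_le) auto
        show "((\<lambda>t. \<bar>sin (y t / 2)\<bar>) \<longlongrightarrow> 0) at_top"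
          using tendsto_rabs_zero[OF tendsto_sin[OF l0, simplified]] .
      qed
      moreover have "((\<lambda>t. (1 / real N * (\<Sum>l=1..N. cos (\<theta> l t - \<theta> i t))) * cos (y t / 2)) \<longlongrightarrow> C * 1) at_top"
        using tendsto_cos[OF l0] by (intro tendsto_mult C) simp
      ultimately show ?thesis using tendsto_diff by fastforce
    qed
    have "\<forall>\<^sub>F t in at_top. s * midpoint_cos i j t < C'"
      by (rule order_tendstoD(2)[OF mid C'(1)])
    with small have "\<forall>\<^sub>F t in at_top.
      2 * \<kappa> * (sin (y t / 2) * y t) * (s * midpoint_cos i j t) \<le> (y t)\<^sup>2 / (4 * m)"
    proof eventually_elim
      case (elim t)
      have "0 \<le> sin (y t / 2) * y t"
      proof (cases "y t \<ge> 0")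
        case True
        then show ?thesis using elim(1) sin_ge_zero[of "y t / 2"] by simp
      next
        case False
        then have "sin (- (y t / 2)) \<ge> 0" using elim(1) by (intro sin_ge_zero) auto
        then show ?thesis using False by (simp add: zero_le_mult_iff)
      qed
      then have p: "0 \<le> 2 * \<kappa> * (sin (y t / 2) * y t)" using \<kappa> by simp
      have "2 * \<kappa> * (sin (y t / 2) * y t) * (s * midpoint_cos i j t)
          \<le> 2 * \<kappa> * (sin (y t / 2) * y t) * C'"
        using elim(2) p by (intro mult_left_mono) auto
      also have "\<dots> \<le> 2 * \<kappa> * ((y t)\<^sup>2 / 2) * C'"
        using sin_y[of t] \<kappa> C'(2) by (intro mult_right_mono mult_left_mono) auto
      also have "\<dots> = (y t)\<^sup>2 / (4 * m)" unfolding C'_def using m kp by (simp add: field_simps)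
      finally show ?case .
    qed
    then show False by (rule not_overdamped)
  qed
qed

end

section \<open>Energy and order parameter\<close>

context kuramoto_path begin

definition mean_cos :: "real \<Rightarrow> real" where
  "mean_cos t = 1 / real N * (\<Sum>j=1..N. cos (\<theta> j t))"

definition mean_sin :: "real \<Rightarrow> real" where
  "mean_sin t = 1 / real N * (\<Sum>j=1..N. sin (\<theta> j t))"

definition order_sq :: "real \<Rightarrow> real" where
  "order_sq t = (mean_cos t)\<^sup>2 + (mean_sin t)\<^sup>2"

text \<open>
  With the order parameter \<open>Z = mean_cos + \<i> mean_sin\<close>, these are the real and imaginary parts of
  \<open>Z exp (- \<i> \<theta> i)\<close>. The coupling acts on oscillator \<open>i\<close> through the imaginary part alone; the real
  part is then known up to sign from \<open>\<bar>Z\<bar>\<close>.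
\<close>

definition rot_re :: "nat \<Rightarrow> real \<Rightarrow> real" where
  "rot_re i t = mean_cos t * cos (\<theta> i t) + mean_sin t * sin (\<theta> i t)"

definition rot_im :: "nat \<Rightarrow> real \<Rightarrow> real" where
  "rot_im i t = mean_sin t * cos (\<theta> i t) - mean_cos t * sin (\<theta> i t)"

lemma rot_im_eq: "rot_im i t = 1 / real N * (\<Sum>j=1..N. sin (\<theta> j t - \<theta> i t))"
  unfolding rot_im_def mean_cos_def mean_sin_def
  by (simp only: sin_diff sum_subtractf sum_distrib_right right_diff_distrib mult.assoc)

lemma ode_rot: "i \<in> {1..N} \<Longrightarrow> t > 0 \<Longrightarrow> m * \<alpha> i t + \<omega> i t = \<nu> i + \<kappa> * rot_im i t"
  using ode unfolding rot_im_eq by simp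

lemma rot_sq: "(rot_re i t)\<^sup>2 + (rot_im i t)\<^sup>2 = order_sq t"
proof -
  have "(rot_re i t)\<^sup>2 + (rot_im i t)\<^sup>2 =
      order_sq t * ((sin (\<theta> i t))\<^sup>2 + (cos (\<theta> i t))\<^sup>2)"
    unfolding rot_re_def rot_im_def order_sq_def by algebra
  then show ?thesis by simp
qed

lemma rot_mult: "rot_re i t * rot_re j t + rot_im i t * rot_im j t = order_sq t * cos (\<theta> i t - \<theta> j t)"
  unfolding rot_re_def rot_im_def order_sq_def cos_diff by algebra

lemma mean_sums: "(\<Sum>i=1..N. cos (\<theta> i t)) = real N * mean_cos t"
  "(\<Sum>i=1..N. sin (\<theta> i t)) = real N * mean_sin t"
  unfolding mean_cos_def mean_sin_def using N by simp_all

lemma sum_rot_re: "(\<Sum>i=1..N. rot_re i t) = real N * order_sq t"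
  unfolding rot_re_def order_sq_def
  by (simp add: sum.distrib mean_sums power2_eq_square algebra_simps del: One_nat_def
      flip: sum_distrib_left)

lemma sum_rot_im: "(\<Sum>i=1..N. rot_im i t) = 0"
  unfolding rot_im_def
  by (simp add: sum_subtractf mean_sums del: One_nat_def flip: sum_distrib_left)

lemma order_sq_nonneg: "0 \<le> order_sq t"
  unfolding order_sq_def by simp

lemma order_sq_le: "order_sq t \<le> 1"
proof -
  have "rot_re i t \<le> sqrt (order_sq t)" for i
    using rot_sq[of i t] by (intro real_le_rsqrt) (smt (verit) zero_le_power2)
  then have "(\<Sum>i=1..N. rot_re i t) \<le> (\<Sum>i=1..N. sqrt (order_sq t))" by (intro sum_mono)
  then have "real N * order_sq t \<le> real N * sqrt (order_sq t)" by (simp add: sum_rot_re del: One_nat_def)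
  then have le: "order_sq t \<le> sqrt (order_sq t)" using N by simp
  show ?thesis
  proof (rule ccontr)
    assume "\<not> ?thesis"
    then have "sqrt (order_sq t) < order_sq t" by (intro real_less_lsqrt) (auto simp: power2_eq_square)
    with le show False by simp
  qed
qed

lemma abs_rot_le: "\<bar>rot_re i t\<bar> \<le> 1" "\<bar>rot_im i t\<bar> \<le> 1"
proof -
  have "(rot_re i t)\<^sup>2 \<le> 1" "(rot_im i t)\<^sup>2 \<le> 1"
    using rot_sq[of i t] order_sq_le[of t] by (smt (verit) zero_le_power2)+
  then show "\<bar>rot_re i t\<bar> \<le> 1" "\<bar>rot_im i t\<bar> \<le> 1" by (auto simp: abs_square_le_1)
qed

lemma cont_theta: "i \<in> {1..N} \<Longrightarrow> continuous_on {0..} (\<theta> i)"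
  using C2_half_line.cont_y[OF C2] .

lemma cont_omega: "i \<in> {1..N} \<Longrightarrow> continuous_on {0..} (\<omega> i)"
  using C2 unfolding C2_half_line_def by blast

lemma d_theta: "i \<in> {1..N} \<Longrightarrow> t > 0 \<Longrightarrow> (\<theta> i has_real_derivative \<omega> i t) (at t)"
  using C2_half_line.deriv1[OF C2] .

lemma d_omega: "i \<in> {1..N} \<Longrightarrow> t > 0 \<Longrightarrow> (\<omega> i has_real_derivative \<alpha> i t) (at t)"
  using C2 unfolding C2_half_line_def by blast

lemma cont_order: "continuous_on {0..} mean_cos" "continuous_on {0..} mean_sin"
    "continuous_on {0..} order_sq" "i \<in> {1..N} \<Longrightarrow> continuous_on {0..} (rot_re i)"
proof -
  show 1: "continuous_on {0..} mean_cos" "continuous_on {0..} mean_sin"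
    unfolding mean_cos_def[abs_def] mean_sin_def[abs_def] by (intro continuous_intros cont_theta; simp)+
  show "continuous_on {0..} order_sq" unfolding order_sq_def[abs_def] by (intro continuous_intros 1)
  show "continuous_on {0..} (rot_re i)" if "i \<in> {1..N}"
    unfolding rot_re_def[abs_def] by (intro continuous_intros 1 cont_theta that)
qed

text \<open>
  Up to an additive constant, the coupling potential is \<open>- \<kappa> * N / 2\<close> times the squared order
  parameter, so this derivative is what makes the energy below dissipate.
\<close>

lemma d_order_sq:
  assumes t: "t > 0"
  shows "(order_sq has_real_derivative 2 / real N * (\<Sum>i=1..N. \<omega> i t * rot_im i t)) (at t)"
proof -
  have c: "(mean_cos has_real_derivative 1 / real N * (\<Sum>i=1..N. - sin (\<theta> i t) * \<omega> i t)) (at t)"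
    unfolding mean_cos_def[abs_def]
    by (intro DERIV_cmult DERIV_sum) (auto intro!: derivative_eq_intros d_theta t)
  have s: "(mean_sin has_real_derivative 1 / real N * (\<Sum>i=1..N. cos (\<theta> i t) * \<omega> i t)) (at t)"
    unfolding mean_sin_def[abs_def]
    by (intro DERIV_cmult DERIV_sum) (auto intro!: derivative_eq_intros d_theta t)
  have "(order_sq has_real_derivative
      2 * mean_cos t * (1 / real N * (\<Sum>i=1..N. - sin (\<theta> i t) * \<omega> i t))
      + 2 * mean_sin t * (1 / real N * (\<Sum>i=1..N. cos (\<theta> i t) * \<omega> i t))) (at t)"
    unfolding order_sq_def[abs_def] by (rule derivative_eq_intros c s refl | simp add: mult_ac)+
  moreover have "(\<Sum>i=1..N. \<omega> i t * rot_im i t) =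
      mean_sin t * (\<Sum>i=1..N. cos (\<theta> i t) * \<omega> i t)
      + mean_cos t * (\<Sum>i=1..N. - sin (\<theta> i t) * \<omega> i t)"
    unfolding rot_im_def sum_distrib_left sum.distrib[symmetric] by (rule sum.cong) (auto simp: algebra_simps)
  moreover have "2 * a * (1 / real N * X) + 2 * b * (1 / real N * Y) = 2 / real N * (b * Y + a * X)"
    for a b X Y :: real by (simp add: algebra_simps add_divide_distrib)
  ultimately show ?thesis by (simp only:)
qed

definition kinetic :: "real \<Rightarrow> real" where
  "kinetic t = (\<Sum>i=1..N. (\<omega> i t)\<^sup>2)"

definition energy :: "real \<Rightarrow> real" where
  "energy t = m / 2 * kinetic t - (\<Sum>i=1..N. \<nu> i * \<theta> i t) - \<kappa> * real N / 2 * order_sq t"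

lemma kinetic_nonneg: "0 \<le> kinetic t"
  unfolding kinetic_def by (intro sum_nonneg) simp

lemma omega_sq_le_kinetic: "i \<in> {1..N} \<Longrightarrow> (\<omega> i t)\<^sup>2 \<le> kinetic t"
  unfolding kinetic_def by (rule member_le_sum) auto

lemma d_kinetic:
  "t > 0 \<Longrightarrow> (kinetic has_real_derivative (\<Sum>i=1..N. 2 * \<omega> i t * \<alpha> i t)) (at t)"
  unfolding kinetic_def[abs_def]
  by (intro DERIV_sum) (auto intro!: derivative_eq_intros d_omega)

lemma d_energy:
  assumes t: "t > 0"
  shows "(energy has_real_derivative - kinetic t) (at t)"
proof -
  have "(energy has_real_derivative m / 2 * (\<Sum>i=1..N. 2 * \<omega> i t * \<alpha> i t)
      - (\<Sum>i=1..N. \<nu> i * \<omega> i t)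
      - \<kappa> * real N / 2 * (2 / real N * (\<Sum>i=1..N. \<omega> i t * rot_im i t))) (at t)"
    unfolding energy_def[abs_def]
    by (intro DERIV_diff DERIV_cmult DERIV_sum d_kinetic d_order_sq d_theta t)
  moreover have "m / 2 * (\<Sum>i=1..N. 2 * \<omega> i t * \<alpha> i t) - (\<Sum>i=1..N. \<nu> i * \<omega> i t)
      - \<kappa> * real N / 2 * (2 / real N * (\<Sum>i=1..N. \<omega> i t * rot_im i t)) =
      (\<Sum>i=1..N. \<omega> i t * (m * \<alpha> i t - \<nu> i - \<kappa> * rot_im i t))"
    using N by (simp add: sum_subtractf sum.distrib sum_distrib_left algebra_simps)
  moreover have "(\<Sum>i=1..N. \<omega> i t * (m * \<alpha> i t - \<nu> i - \<kappa> * rot_im i t)) = - kinetic t"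
    unfolding kinetic_def sum_negf[symmetric]
  proof (rule sum.cong[OF refl])
    fix i assume "i \<in> {1..N}"
    then have "m * \<alpha> i t - \<nu> i - \<kappa> * rot_im i t = - \<omega> i t" using ode_rot[of i t] t by simp
    then show "\<omega> i t * (m * \<alpha> i t - \<nu> i - \<kappa> * rot_im i t) = - (\<omega> i t)\<^sup>2"
      by (simp add: power2_eq_square)
  qed
  ultimately show ?thesis by simp
qed

lemma cont_energy: "continuous_on {0..} energy"
  unfolding energy_def[abs_def] kinetic_def[abs_def]
  by (intro continuous_intros cont_order cont_omega cont_theta) auto

lemma energy_antimono:
  assumes "0 \<le> s" "s \<le> t"
  shows "energy t \<le> energy s"
proof (rule DERIV_nonpos_imp_decreasing_open[OF assms(2)])
  show "continuous_on {s..t} energy" by (rule continuous_on_subset[OF cont_energy]) (use assms in auto)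
  fix x assume "s < x" "x < t"
  then show "\<exists>y. (energy has_real_derivative y) (at x) \<and> y \<le> 0"
    using d_energy[of x] kinetic_nonneg[of x] assms by (intro exI[of _ "- kinetic x"]) auto
qed

end

section \<open>Bounded paths are asymptotically stationary\<close>

locale bounded_kuramoto_path = kuramoto_path +
  fixes B :: real
  assumes bounded: "i \<in> {1..N} \<Longrightarrow> t \<ge> 0 \<Longrightarrow> \<bar>\<theta> i t\<bar> \<le> B"
begin

text \<open>
  The linear part \<open>- (\<Sum>i. \<nu> i * \<theta> i)\<close> of the potential is the only unbounded one, so this is where
  boundedness of the path enters.
\<close>

lemma energy_lower_bound:
  assumes "t \<ge> 0"
  shows "m / 2 * kinetic t - ((\<Sum>i=1..N. \<bar>\<nu> i\<bar> * B) + \<kappa> * real N / 2) \<le> energy t"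
proof -
  have "(\<Sum>i=1..N. \<nu> i * \<theta> i t) \<le> (\<Sum>i=1..N. \<bar>\<nu> i\<bar> * B)"
  proof (rule sum_mono)
    fix i assume "i \<in> {1..N}"
    then have "\<bar>\<nu> i\<bar> * \<bar>\<theta> i t\<bar> \<le> \<bar>\<nu> i\<bar> * B" using bounded assms by (intro mult_left_mono) auto
    then show "\<nu> i * \<theta> i t \<le> \<bar>\<nu> i\<bar> * B" by (metis abs_le_D1 abs_mult)
  qed
  moreover have "\<kappa> * real N / 2 * order_sq t \<le> \<kappa> * real N / 2 * 1"
    using \<kappa> order_sq_le by (intro mult_left_mono) auto
  ultimately show ?thesis unfolding energy_def by simp
qed

lemma energy_converges: "\<exists>L. (energy \<longlongrightarrow> L) at_top \<and> (\<forall>t\<ge>0. L \<le> energy t)"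
proof (rule convergent_if_antimono_bounded_below)
  show "energy t \<le> energy s" if "0 \<le> s" "s \<le> t" for s t by (rule energy_antimono[OF that])
  show "- ((\<Sum>i=1..N. \<bar>\<nu> i\<bar> * B) + \<kappa> * real N / 2) \<le> energy t" if "t \<ge> 0" for t
    using energy_lower_bound[OF that] m kinetic_nonneg[of t]
    by (smt (verit) mult_nonneg_nonneg divide_nonneg_nonneg)
qed

lemma frequencies_bounded: "\<exists>W. \<forall>i\<in>{1..N}. \<forall>t\<ge>0. \<bar>\<omega> i t\<bar> \<le> W"
proof -
  define Q where "Q = 2 / m * (energy 0 + ((\<Sum>i=1..N. \<bar>\<nu> i\<bar> * B) + \<kappa> * real N / 2))"
  have "\<bar>\<omega> i t\<bar> \<le> sqrt Q" if "i \<in> {1..N}" "t \<ge> 0" for i t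
  proof -
    have "m / 2 * kinetic t \<le> energy 0 + ((\<Sum>i=1..N. \<bar>\<nu> i\<bar> * B) + \<kappa> * real N / 2)"
      using energy_lower_bound[of t] energy_antimono[of 0 t] that by simp
    then have "kinetic t \<le> Q" unfolding Q_def using m by (simp add: field_simps)
    then have "(\<omega> i t)\<^sup>2 \<le> Q" using omega_sq_le_kinetic[OF that(1), of t] by simp
    then have "\<bar>\<omega> i t\<bar>\<^sup>2 \<le> Q" by simp
    then show ?thesis by (rule real_le_rsqrt)
  qed
  then show ?thesis by blast
qed

lemma accelerations_bounded: "\<exists>A. \<forall>i\<in>{1..N}. \<forall>t>0. \<bar>\<alpha> i t\<bar> \<le> A"
proof -
  obtain W where W: "\<And>i t. i \<in> {1..N} \<Longrightarrow> t \<ge> 0 \<Longrightarrow> \<bar>\<omega> i t\<bar> \<le> W"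
    using frequencies_bounded by blast
  have "\<bar>\<alpha> i t\<bar> \<le> ((\<Sum>i=1..N. \<bar>\<nu> i\<bar>) + \<kappa> + W) / m" if i: "i \<in> {1..N}" and t: "t > 0" for i t
  proof -
    have "m * \<alpha> i t = \<nu> i + \<kappa> * rot_im i t - \<omega> i t" using ode_rot[OF i t] by simp
    then have "\<bar>m * \<alpha> i t\<bar> \<le> \<bar>\<nu> i\<bar> + \<bar>\<kappa> * rot_im i t\<bar> + \<bar>\<omega> i t\<bar>" by linarith
    also have "\<bar>\<kappa> * rot_im i t\<bar> \<le> \<kappa>" using \<kappa> abs_rot_le(2) by (simp add: abs_mult mult_left_le)
    also have "\<bar>\<nu> i\<bar> \<le> (\<Sum>i=1..N. \<bar>\<nu> i\<bar>)" using i by (intro member_le_sum) auto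
    also have "\<bar>\<omega> i t\<bar> \<le> W" using W i t by simp
    finally show ?thesis using m by (simp add: abs_mult field_simps)
  qed
  then show ?thesis by blast
qed

lemma frequencies_vanish:
  assumes i: "i \<in> {1..N}"
  shows "(\<omega> i \<longlongrightarrow> 0) at_top"
proof -
  obtain W where W: "\<And>i t. i \<in> {1..N} \<Longrightarrow> t \<ge> 0 \<Longrightarrow> \<bar>\<omega> i t\<bar> \<le> W"
    using frequencies_bounded by blast
  obtain A where A: "\<And>i t. i \<in> {1..N} \<Longrightarrow> t > 0 \<Longrightarrow> \<bar>\<alpha> i t\<bar> \<le> A"
    using accelerations_bounded by blast
  obtain L where "(energy \<longlongrightarrow> L) at_top" using energy_converges by blast
  then have "((\<lambda>t. - kinetic t) \<longlongrightarrow> 0) at_top"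
  proof (rule barbalat)
    show "((\<lambda>t. - kinetic t) has_real_derivative - (\<Sum>i=1..N. 2 * \<omega> i t * \<alpha> i t)) (at t)"
      if "t > 0" for t by (rule DERIV_minus[OF d_kinetic[OF that]])
    show "\<bar>- (\<Sum>i=1..N. 2 * \<omega> i t * \<alpha> i t)\<bar> \<le> (\<Sum>i=1..N. 2 * W * A)" if t: "t > 0" for t
    proof -
      have "\<bar>- (\<Sum>i=1..N. 2 * \<omega> i t * \<alpha> i t)\<bar> \<le> (\<Sum>i=1..N. \<bar>2 * \<omega> i t * \<alpha> i t\<bar>)"
        unfolding abs_minus_cancel by (rule sum_abs)
      also have "\<dots> \<le> (\<Sum>i=1..N. 2 * W * A)"
      proof (rule sum_mono)
        fix i assume j: "i \<in> {1..N}"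
        have "0 \<le> W" using W[OF j, of t] t by linarith
        then have "\<bar>\<omega> i t\<bar> * \<bar>\<alpha> i t\<bar> \<le> W * A" using W[OF j, of t] A[OF j t] t by (intro mult_mono) auto
        then show "\<bar>2 * \<omega> i t * \<alpha> i t\<bar> \<le> 2 * W * A" by (simp add: abs_mult)
      qed
      finally show ?thesis .
    qed
  qed (rule d_energy)
  then have "(kinetic \<longlongrightarrow> 0) at_top" using tendsto_minus by fastforce
  then have "((\<lambda>t. sqrt (kinetic t)) \<longlongrightarrow> 0) at_top" using tendsto_real_sqrt by fastforce
  then show ?thesis
  proof (rule Lim_null_comparison[rotated])
    show "\<forall>\<^sub>F t in at_top. norm (\<omega> i t) \<le> sqrt (kinetic t)"
      using omega_sq_le_kinetic[OF i] by (auto intro!: always_eventually real_le_rsqrt)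
  qed
qed

text \<open>
  The frequencies tend to \<open>0\<close>, and the accelerations are Lipschitz since the equation can be
  differentiated once more; Barbalat's lemma makes the accelerations vanish in the limit as well.
\<close>

lemma forces_vanish:
  assumes i: "i \<in> {1..N}"
  shows "((\<lambda>t. \<nu> i + \<kappa> * rot_im i t) \<longlongrightarrow> 0) at_top"
proof -
  obtain W where W: "\<And>i t. i \<in> {1..N} \<Longrightarrow> t \<ge> 0 \<Longrightarrow> \<bar>\<omega> i t\<bar> \<le> W"
    using frequencies_bounded by blast
  obtain A where A: "\<And>i t. i \<in> {1..N} \<Longrightarrow> t > 0 \<Longrightarrow> \<bar>\<alpha> i t\<bar> \<le> A"
    using accelerations_bounded by blast
  define dI where "dI = (\<lambda>t. 1 / real N * (\<Sum>j=1..N. cos (\<theta> j t - \<theta> i t) * (\<omega> j t - \<omega> i t)))"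
  have dI: "(rot_im i has_real_derivative dI t) (at t)" if t: "t > 0" for t
    unfolding rot_im_eq[abs_def] dI_def
    by (intro DERIV_cmult DERIV_sum) (auto intro!: derivative_eq_intros d_theta t i)
  have bI: "\<bar>dI t\<bar> \<le> 2 * W" if t: "t > 0" for t
  proof -
    have "\<bar>\<Sum>j=1..N. cos (\<theta> j t - \<theta> i t) * (\<omega> j t - \<omega> i t)\<bar> \<le> (\<Sum>j=1..N. 2 * W)"
    proof (rule order_trans[OF sum_abs sum_mono])
      fix j assume j: "j \<in> {1..N}"
      have "\<bar>\<omega> j t - \<omega> i t\<bar> \<le> 2 * W" using W[OF j, of t] W[OF i, of t] t by linarith
      then have "\<bar>cos (\<theta> j t - \<theta> i t)\<bar> * \<bar>\<omega> j t - \<omega> i t\<bar> \<le> 1 * (2 * W)"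
        by (intro mult_mono) auto
      then show "\<bar>cos (\<theta> j t - \<theta> i t) * (\<omega> j t - \<omega> i t)\<bar> \<le> 2 * W" by (simp add: abs_mult)
    qed
    then show ?thesis using N unfolding dI_def by (simp add: abs_mult field_simps)
  qed
  have "(\<alpha> i \<longlongrightarrow> 0) at_top"
  proof (rule barbalat[OF frequencies_vanish[OF i]])
    show "(\<omega> i has_real_derivative \<alpha> i t) (at t)" if "t > 0" for t by (rule d_omega[OF i that])
    show "(\<alpha> i has_real_derivative (\<kappa> * dI t - \<alpha> i t) / m) (at t)" if t: "t > 0" for t
    proof (rule has_field_derivative_transform_within_open[of "\<lambda>t. (\<nu> i + \<kappa> * rot_im i t - \<omega> i t) / m" _ _ "{0<..}"])
      show "((\<lambda>t. (\<nu> i + \<kappa> * rot_im i t - \<omega> i t) / m) has_real_derivative (\<kappa> * dI t - \<alpha> i t) / m) (at t)"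
        using m by (auto intro!: derivative_eq_intros dI d_omega t i)
      show "(\<nu> i + \<kappa> * rot_im i t - \<omega> i t) / m = \<alpha> i t" if "t \<in> {0<..}" for t
        using ode_rot[OF i, of t] that m by (simp add: field_simps)
    qed (use t in auto)
    show "\<bar>(\<kappa> * dI t - \<alpha> i t) / m\<bar> \<le> (\<kappa> * (2 * W) + A) / m" if t: "t > 0" for t
    proof -
      have "\<bar>\<kappa> * dI t\<bar> \<le> \<kappa> * (2 * W)" using bI[OF t] \<kappa> by (simp add: abs_mult mult_left_mono)
      then have "\<bar>\<kappa> * dI t - \<alpha> i t\<bar> \<le> \<kappa> * (2 * W) + A" using A[OF i t] by linarith
      then show ?thesis using m by (simp add: abs_divide divide_right_mono)
    qed
  qed
  then have "((\<lambda>t. m * \<alpha> i t + \<omega> i t) \<longlongrightarrow> m * 0 + 0) at_top"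
    by (intro tendsto_intros frequencies_vanish[OF i])
  then show ?thesis
  proof (rule Lim_transform_eventually[THEN tendsto_eq_rhs])
    show "\<forall>\<^sub>F t in at_top. m * \<alpha> i t + \<omega> i t = \<nu> i + \<kappa> * rot_im i t"
      using eventually_gt_at_top[of 0] by eventually_elim (rule ode_rot[OF i])
  qed simp
qed

end

section \<open>Bounded paths phase-lock\<close>

context bounded_kuramoto_path begin

lemma rot_im_tendsto:
  assumes "\<kappa> > 0" and i: "i \<in> {1..N}"
  shows "(rot_im i \<longlongrightarrow> - \<nu> i / \<kappa>) at_top"
proof -
  have "((\<lambda>t. ((\<nu> i + \<kappa> * rot_im i t) - \<nu> i) / \<kappa>) \<longlongrightarrow> (0 - \<nu> i) / \<kappa>) at_top"
    using assms(1) by (intro tendsto_intros forces_vanish[OF i]) simp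
  then show ?thesis using assms(1) by simp
qed

text \<open>
  Along times with \<open>\<bar>Z\<bar>\<^sup>2 = v\<close>, the imaginary parts of \<open>Z exp (- \<i> \<theta> i)\<close> tend to \<open>- \<nu> i / \<kappa>\<close>, so the
  moduli of the real parts tend to \<open>sqrt (v - (\<nu> i / \<kappa>)\<^sup>2)\<close>; and the real parts add up to exactly \<open>N * v\<close>.
  The signs may change from time to time, which is why the product over all sign patterns occurs.
\<close>

lemma recurrent_order_value:
  assumes \<kappa>: "\<kappa> > 0" and freq: "\<exists>\<^sub>F t in at_top. order_sq t = v"
  shows "\<And>i. i \<in> {1..N} \<Longrightarrow> (\<nu> i / \<kappa>)\<^sup>2 \<le> v"
    and "(\<Prod>J\<in>Pow {1..N}. real (card {1..N}) * v -
      (\<Sum>i\<in>{1..N}. (if i \<in> J then 1 else - 1) * sqrt (v - (\<nu> i / \<kappa>)\<^sup>2))) = 0"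
proof -
  \<comment> \<open>Limits along the late times at which the value \<open>v\<close> is taken.\<close>
  define F where "F = inf at_top (principal {t. order_sq t = v})"
  have ntF: "F \<noteq> bot"
    using freq unfolding F_def trivial_limit_def eventually_inf_principal frequently_def by simp
  have on_F: "\<forall>\<^sub>F t in F. order_sq t = v" unfolding F_def eventually_inf_principal by simp
  have F: "F \<le> at_top" unfolding F_def by simp
  have im: "((\<lambda>t. v - (rot_im i t)\<^sup>2) \<longlongrightarrow> v - (\<nu> i / \<kappa>)\<^sup>2) F" if "i \<in> {1..N}" for i
  proof -
    have "((\<lambda>t. v - (rot_im i t)\<^sup>2) \<longlongrightarrow> v - (- \<nu> i / \<kappa>)\<^sup>2) F"
      by (intro tendsto_intros tendsto_mono[OF F rot_im_tendsto[OF \<kappa> that]])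
    then show ?thesis by simp
  qed
  have re: "\<forall>\<^sub>F t in F. v - (rot_im i t)\<^sup>2 = (rot_re i t)\<^sup>2" for i
    using on_F by eventually_elim (use rot_sq[of i] in \<open>simp add: algebra_simps\<close>)
  show "(\<nu> i / \<kappa>)\<^sup>2 \<le> v" if i: "i \<in> {1..N}" for i
  proof -
    have "\<forall>\<^sub>F t in F. 0 \<le> v - (rot_im i t)\<^sup>2" using re[of i] by eventually_elim simp
    then have "0 \<le> v - (\<nu> i / \<kappa>)\<^sup>2" using tendsto_lowerbound[OF im[OF i] _ ntF] by blast
    then show ?thesis by simp
  qed
  have abs_re: "((\<lambda>t. \<bar>rot_re i t\<bar>) \<longlongrightarrow> sqrt (v - (\<nu> i / \<kappa>)\<^sup>2)) F" if "i \<in> {1..N}" for i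
  proof (rule Lim_transform_eventually[OF tendsto_real_sqrt[OF im[OF that]]])
    show "\<forall>\<^sub>F t in F. sqrt (v - (rot_im i t)\<^sup>2) = \<bar>rot_re i t\<bar>"
      using re[of i] by eventually_elim simp
  qed
  define P where "P = (\<lambda>t. \<Prod>J\<in>Pow {1..N}. real (card {1..N}) * v -
      (\<Sum>i\<in>{1..N}. (if i \<in> J then 1 else - 1) * \<bar>rot_re i t\<bar>))"
  have "(P \<longlongrightarrow> (\<Prod>J\<in>Pow {1..N}. real (card {1..N}) * v -
      (\<Sum>i\<in>{1..N}. (if i \<in> J then 1 else - 1) * sqrt (v - (\<nu> i / \<kappa>)\<^sup>2)))) F"
    unfolding P_def by (intro tendsto_intros abs_re)
  moreover have "\<forall>\<^sub>F t in F. P t = 0"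
    using on_F
  proof eventually_elim
    case (elim t)
    define J where "J = {i \<in> {1..N}. rot_re i t \<ge> 0}"
    have "(\<Sum>i\<in>{1..N}. (if i \<in> J then 1 else - 1) * \<bar>rot_re i t\<bar>) = (\<Sum>i=1..N. rot_re i t)"
      by (rule sum.cong) (auto simp: J_def)
    also have "\<dots> = real (card {1..N}) * v" using sum_rot_re elim by simp
    finally have "\<exists>J\<in>Pow {1..N}. real (card {1..N}) * v -
      (\<Sum>i\<in>{1..N}. (if i \<in> J then 1 else - 1) * \<bar>rot_re i t\<bar>) = 0"
      by (intro bexI[of _ J]) (auto simp: J_def)
    then show ?case unfolding P_def by (intro prod_zero) auto
  qed
  then have "(P \<longlongrightarrow> 0) F" by (rule tendsto_eventually)
  ultimately show "(\<Prod>J\<in>Pow {1..N}. real (card {1..N}) * v -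
      (\<Sum>i\<in>{1..N}. (if i \<in> J then 1 else - 1) * sqrt (v - (\<nu> i / \<kappa>)\<^sup>2))) = 0"
    by (rule tendsto_unique[OF ntF])
qed

lemma order_sq_converges:
  assumes \<kappa>: "\<kappa> > 0"
  shows "\<exists>u. (order_sq \<longlongrightarrow> u) at_top"
proof (rule convergent_if_few_recurrent_values[OF cont_order(3), of 1])
  show "\<bar>order_sq t\<bar> \<le> 1" for t using order_sq_nonneg[of t] order_sq_le[of t] by simp
  fix a b :: real assume ab: "a < b"
  show "\<exists>v\<in>{a<..<b}. \<not> (\<exists>\<^sub>F t in at_top. order_sq t = v)"
  proof (rule ccontr)
    assume "\<not> ?thesis"
    then have rec: "\<exists>\<^sub>F t in at_top. order_sq t = v" if "v \<in> {a<..<b}" for v using that by blast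
    define p where "p = (a + b) / 2"
    \<comment> \<open>Being recurrent itself, \<open>p\<close> bounds all \<open>(\<nu> i / \<kappa>)\<^sup>2\<close>, so the square roots are real
      and differentiable to the right of \<open>p\<close>.\<close>
    have p: "p \<in> {a<..<b}" unfolding p_def using ab by simp
    have "\<exists>v\<in>{p<..<b}. (\<Prod>J\<in>Pow {1..N}. real (card {1..N}) * v -
      (\<Sum>i\<in>{1..N}. (if i \<in> J then 1 else - 1) * sqrt (v - (\<nu> i / \<kappa>)\<^sup>2))) \<noteq> 0"
    proof (rule signed_sqrt_sums_not_vanishing_on_interval)
      show "(\<nu> i / \<kappa>)\<^sup>2 \<le> p" if "i \<in> {1..N}" for i
        by (rule recurrent_order_value(1)[OF \<kappa> rec[OF p] that])
    qed (use N p in auto)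
    then obtain v where v: "v \<in> {p<..<b}" "(\<Prod>J\<in>Pow {1..N}. real (card {1..N}) * v -
      (\<Sum>i\<in>{1..N}. (if i \<in> J then 1 else - 1) * sqrt (v - (\<nu> i / \<kappa>)\<^sup>2))) \<noteq> 0" by blast
    then show False using recurrent_order_value(2)[OF \<kappa> rec[of v]] p by auto
  qed
qed

text \<open>
  The square of the real part of \<open>Z exp (- \<i> \<theta> i)\<close> converges, and so by continuity does the real part.
  Multiplying \<open>Z exp (- \<i> \<theta> i)\<close> by the conjugate of \<open>Z exp (- \<i> \<theta> j)\<close> recovers
  \<open>\<bar>Z\<bar>\<^sup>2 cos (\<theta> i - \<theta> j)\<close>.
\<close>

lemma differences_converge_if_ordered:
  assumes \<kappa>: "\<kappa> > 0" and u: "(order_sq \<longlongrightarrow> u) at_top" "u > 0"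
    and ij: "i \<in> {1..N}" "j \<in> {1..N}"
  shows "\<exists>L. ((\<lambda>t. \<theta> i t - \<theta> j t) \<longlongrightarrow> L) at_top"
proof -
  have re: "\<exists>r. (rot_re i \<longlongrightarrow> r) at_top" if i: "i \<in> {1..N}" for i
  proof (rule convergent_if_image_converges[OF cont_order(4)[OF i]])
    show "\<bar>rot_re i t\<bar> \<le> 1" for t by (rule abs_rot_le)
    have "((\<lambda>t. order_sq t - (rot_im i t)\<^sup>2) \<longlongrightarrow> u - (- \<nu> i / \<kappa>)\<^sup>2) at_top"
      by (intro tendsto_intros u rot_im_tendsto \<kappa> i)
    moreover have "order_sq t - (rot_im i t)\<^sup>2 = (rot_re i t)\<^sup>2" for t using rot_sq[of i t] by simp
    ultimately show "((\<lambda>t. (rot_re i t)\<^sup>2) \<longlongrightarrow> u - (- \<nu> i / \<kappa>)\<^sup>2) at_top" by simp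
    show "\<exists>v\<in>{a<..<b}. v\<^sup>2 \<noteq> u - (- \<nu> i / \<kappa>)\<^sup>2" if ab: "a < b" for a b :: real
    proof (rule ccontr)
      assume "\<not> ?thesis"
      then have sq: "v\<^sup>2 = u - (- \<nu> i / \<kappa>)\<^sup>2" if "v \<in> {a<..<b}" for v using that by blast
      let ?v = "(2 * a + b) / 3" and ?w = "(a + b) / 2" and ?z = "(a + 2 * b) / 3"
      have "?v\<^sup>2 = ?w\<^sup>2" "?w\<^sup>2 = ?z\<^sup>2" using sq[of ?v] sq[of ?w] sq[of ?z] ab by auto
      then have "?v = ?w \<or> ?v = - ?w" "?w = ?z \<or> ?w = - ?z" unfolding power2_eq_iff .
      then show False using ab by (auto simp: field_simps)
    qed
  qed
  obtain ri where ri: "(rot_re i \<longlongrightarrow> ri) at_top" using re ij by blast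
  obtain rj where rj: "(rot_re j \<longlongrightarrow> rj) at_top" using re ij by blast
  show ?thesis
  proof (rule convergent_if_image_converges[OF cont_diff[OF ij]])
    show "\<bar>\<theta> i t - \<theta> j t\<bar> \<le> 2 * B" if "t \<ge> 0" for t
      using bounded[OF ij(1) that] bounded[OF ij(2) that] by linarith
    let ?c = "(ri * rj + (- \<nu> i / \<kappa>) * (- \<nu> j / \<kappa>)) / u"
    have "((\<lambda>t. (rot_re i t * rot_re j t + rot_im i t * rot_im j t) / order_sq t) \<longlongrightarrow> ?c) at_top"
      using u(2) by (intro tendsto_intros u(1) ri rj rot_im_tendsto \<kappa> ij) simp
    moreover have "\<forall>\<^sub>F t in at_top. order_sq t > 0" by (rule order_tendstoD(1)[OF u])
    then have "\<forall>\<^sub>F t in at_top. (rot_re i t * rot_re j t + rot_im i t * rot_im j t) / order_sq t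
        = cos (\<theta> i t - \<theta> j t)"
      by eventually_elim (simp add: rot_mult)
    ultimately show "((\<lambda>t. cos (\<theta> i t - \<theta> j t)) \<longlongrightarrow> ?c) at_top" by (rule Lim_transform_eventually)
    show "\<exists>v\<in>{a<..<b}. cos v \<noteq> ?c" if "a < b" for a b by (rule cos_not_constant_on_interval[OF that])
  qed
qed

text \<open>
  With all \<open>\<nu> i\<close> equal to \<open>0\<close> the potential is nonpositive and tends to \<open>0\<close>, so the energy \<open>E\<close>
  decreases to \<open>0\<close> and satisfies \<open>2 * m * E \<le> m\<^sup>2 * K\<close> for \<open>K = (\<Sum>i. (\<omega> i)\<^sup>2)\<close>. As \<open>E' = - K\<close>, the function
  \<open>h = sqrt (2 * m * E)\<close> decreases at least at the rate \<open>sqrt K \<ge> \<bar>\<omega> i\<bar>\<close>. Hence \<open>h + \<theta> i\<close> is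
  nonincreasing, and it converges because \<open>\<theta> i\<close> is bounded.
\<close>

lemma phases_converge_if_disordered:
  assumes \<nu>: "\<And>i. i \<in> {1..N} \<Longrightarrow> \<nu> i = 0" and dis: "((\<lambda>t. \<kappa> * order_sq t) \<longlongrightarrow> 0) at_top"
    and i: "i \<in> {1..N}"
  shows "\<exists>L. (\<theta> i \<longlongrightarrow> L) at_top"
proof -
  have E: "energy t = m / 2 * kinetic t - real N / 2 * (\<kappa> * order_sq t)" for t
    unfolding energy_def using \<nu> by simp
  have "(kinetic \<longlongrightarrow> (\<Sum>i=1..N. 0\<^sup>2)) at_top"
    unfolding kinetic_def[abs_def] by (intro tendsto_intros frequencies_vanish)
  then have kin: "(kinetic \<longlongrightarrow> 0) at_top" by simp
  have "((\<lambda>t. m / 2 * kinetic t - real N / 2 * (\<kappa> * order_sq t)) \<longlongrightarrow> m / 2 * 0 - real N / 2 * 0) at_top"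
    by (intro tendsto_intros kin dis)
  then have lim: "(energy \<longlongrightarrow> 0) at_top" unfolding E[abs_def] by simp
  have pos: "0 \<le> energy t" if "t \<ge> 0" for t
    using energy_converges tendsto_unique[OF _ lim] that by force
  have below: "2 * m * energy t \<le> m\<^sup>2 * kinetic t" for t
  proof -
    have "0 \<le> m * (real N * (\<kappa> * order_sq t))" using m \<kappa> order_sq_nonneg[of t] by simp
    then show ?thesis unfolding E by (simp add: algebra_simps power2_eq_square)
  qed
  show ?thesis
  \<comment> \<open>If the energy reaches \<open>0\<close> the motion stops; otherwise its square root is differentiable.\<close>
  proof (cases "\<exists>T\<ge>0. energy T = 0")
    case True
    then obtain T where T: "T \<ge> 0" "energy T = 0" by blast
    have E0: "energy t = 0" if "t \<ge> T" for t
      using energy_antimono[OF T(1) that] pos[of t] T that by simp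
    have om: "\<omega> i t = 0" if t: "t > T" for t
    proof -
      have "((\<lambda>_. 0) has_real_derivative - kinetic t) (at t)"
        by (rule has_field_derivative_transform_within_open[of energy _ _ "{T<..}"])
          (use t T E0 d_energy in auto)
      then have "kinetic t = 0" using DERIV_unique[OF _ DERIV_const] by fastforce
      then show ?thesis using omega_sq_le_kinetic[OF i, of t] by simp
    qed
    have "\<theta> i t = \<theta> i (T + 1)" if "t \<ge> T + 1" for t
    proof (cases "t = T + 1")
      case False
      then have "T + 1 < t" using that by simp
      then show ?thesis
      proof (rule DERIV_isconst_end)
        show "continuous_on {T + 1..t} (\<theta> i)"
          by (rule continuous_on_subset[OF cont_theta[OF i]]) (use T in auto)
        show "(\<theta> i has_real_derivative 0) (at x)" if "T + 1 < x" for x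
          using d_theta[OF i, of x] om[of x] that T by simp
      qed
    qed simp
    then have "\<forall>\<^sub>F t in at_top. \<theta> i t = \<theta> i (T + 1)"
      unfolding eventually_at_top_linorder by blast
    then show ?thesis using tendsto_eventually by blast
  next
    case False
    then have Epos: "energy t > 0" if "t \<ge> 0" for t using pos[OF that] that by force
    define h where "h = (\<lambda>t. sqrt (2 * m * energy t))"
    have h: "h t > 0" if "t \<ge> 0" for t unfolding h_def using Epos[OF that] m by simp
    have dh: "(h has_real_derivative - (m * kinetic t / h t)) (at t)" if t: "t > 0" for t
    proof -
      have "2 * m * energy t > 0" using Epos[of t] t m by simp
      then show ?thesis
        using DERIV_chain2[OF DERIV_real_sqrt DERIV_cmult[OF d_energy[OF t], of "2 * m"]]
        unfolding h_def by (simp add: field_simps)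
    qed
    have speed: "\<bar>\<omega> i t\<bar> \<le> m * kinetic t / h t" if t: "t > 0" for t
    proof -
      have "h t \<le> sqrt (m\<^sup>2 * kinetic t)" unfolding h_def using below by simp
      also have "\<dots> = m * sqrt (kinetic t)" using m by (simp add: real_sqrt_mult)
      finally have "sqrt (kinetic t) * h t \<le> sqrt (kinetic t) * (m * sqrt (kinetic t))"
        using kinetic_nonneg by (intro mult_left_mono) auto
      then have "sqrt (kinetic t) * h t \<le> m * kinetic t"
        using kinetic_nonneg[of t] by (simp add: algebra_simps)
      then have "sqrt (kinetic t) \<le> m * kinetic t / h t" using h[of t] t by (simp add: field_simps)
      moreover have "\<bar>\<omega> i t\<bar> \<le> sqrt (kinetic t)"
        using omega_sq_le_kinetic[OF i] by (intro real_le_rsqrt) simp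
      ultimately show ?thesis by simp
    qed
    have "\<exists>L. ((\<lambda>t. h t + \<theta> i t) \<longlongrightarrow> L) at_top \<and> (\<forall>t\<ge>1. L \<le> h t + \<theta> i t)"
    proof (rule convergent_if_antimono_bounded_below)
      fix s t :: real assume st: "1 \<le> s" "s \<le> t"
      show "h t + \<theta> i t \<le> h s + \<theta> i s"
      proof (rule DERIV_nonpos_imp_nonincreasing[OF st(2)])
        fix x assume "s \<le> x"
        then have x: "x > 0" using st by simp
        have "((\<lambda>t. h t + \<theta> i t) has_real_derivative - (m * kinetic x / h x) + \<omega> i x) (at x)"
          by (intro DERIV_add dh d_theta i x)
        then show "\<exists>y. ((\<lambda>t. h t + \<theta> i t) has_real_derivative y) (at x) \<and> y \<le> 0"
          using speed[OF x] by (intro exI[of _ "- (m * kinetic x / h x) + \<omega> i x"]) auto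
      qed
    next
      show "- B \<le> h t + \<theta> i t" if "t \<ge> 1" for t
        using bounded[OF i, of t] h[of t] that by simp
    qed
    then obtain L where "((\<lambda>t. h t + \<theta> i t) \<longlongrightarrow> L) at_top" by blast
    moreover have "(h \<longlongrightarrow> sqrt (2 * m * 0)) at_top" unfolding h_def by (intro tendsto_intros lim)
    ultimately have "((\<lambda>t. h t + \<theta> i t - h t) \<longlongrightarrow> L - sqrt (2 * m * 0)) at_top" by (rule tendsto_diff)
    then show ?thesis by auto
  qed
qed

lemma bounded_path_phase_locks:
  assumes ij: "i \<in> {1..N}" "j \<in> {1..N}"
  shows "\<exists>L. ((\<lambda>t. \<theta> i t - \<theta> j t) \<longlongrightarrow> L) at_top"
proof -
  have disordered: ?thesis
    if \<nu>: "\<And>i. i \<in> {1..N} \<Longrightarrow> \<nu> i = 0" and dis: "((\<lambda>t. \<kappa> * order_sq t) \<longlongrightarrow> 0) at_top"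
  proof -
    obtain a b where "(\<theta> i \<longlongrightarrow> a) at_top" "(\<theta> j \<longlongrightarrow> b) at_top"
      using phases_converge_if_disordered[OF \<nu> dis] ij by meson
    then show ?thesis using tendsto_diff by blast
  qed
  show ?thesis
  proof (cases "\<kappa> = 0")
    case True
    have "\<nu> i = 0" if "i \<in> {1..N}" for i
      using forces_vanish[OF that] True tendsto_const_iff[of "at_top :: real filter" "\<nu> i" 0] by simp
    then show ?thesis using disordered True by simp
  next
    case False
    then have kp: "\<kappa> > 0" using \<kappa> by simp
    obtain u where u: "(order_sq \<longlongrightarrow> u) at_top" using order_sq_converges[OF kp] by blast
    have "u \<ge> 0" by (rule tendsto_lowerbound[OF u]) (auto simp: order_sq_nonneg)
    show ?thesis
    proof (cases "u = 0")
      case True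
      have "\<nu> i = 0" if i: "i \<in> {1..N}" for i
      proof -
        have "((\<lambda>t. sqrt (order_sq t)) \<longlongrightarrow> 0) at_top" using tendsto_real_sqrt[OF u] True by simp
        then have "(rot_im i \<longlongrightarrow> 0) at_top"
        proof (rule Lim_null_comparison[rotated])
          show "\<forall>\<^sub>F t in at_top. norm (rot_im i t) \<le> sqrt (order_sq t)"
            using rot_sq[of i] by (auto intro!: always_eventually real_le_rsqrt simp flip: rot_sq[of i])
        qed
        then show ?thesis using tendsto_unique[OF _ rot_im_tendsto[OF kp i]] kp by force
      qed
      moreover have "((\<lambda>t. \<kappa> * order_sq t) \<longlongrightarrow> 0) at_top"
        using tendsto_mult[OF tendsto_const[of \<kappa>] u] True by simp
      ultimately show ?thesis by (rule disordered)
    next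
      case False
      then show ?thesis using differences_converge_if_ordered[OF kp u _ ij] \<open>u \<ge> 0\<close> by simp
    qed
  qed
qed

end

section \<open>From bounded differences to the theorem\<close>

context kuramoto_path begin

definition centred :: "(nat \<Rightarrow> real \<Rightarrow> real) \<Rightarrow> nat \<Rightarrow> real \<Rightarrow> real" where
  "centred f i t = f i t - 1 / real N * (\<Sum>j=1..N. f j t)"

text \<open>
  The coupling forces cancel in the sum over all oscillators, so the mean phase obeys the
  uncoupled equation with the mean natural frequency and can be subtracted.
\<close>

lemma centred_path:
  "kuramoto_path N m \<kappa> (\<lambda>i. \<nu> i - 1 / real N * (\<Sum>j=1..N. \<nu> j)) (centred \<theta>) (centred \<omega>) (centred \<alpha>)"
proof (rule kuramoto_path.intro)
  show "1 \<le> N" "0 < m" "0 \<le> \<kappa>" by (rule N m \<kappa>)+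
  fix i assume i: "i \<in> {1..N}"
  have d0: "(\<theta> j has_real_derivative \<omega> j t) (at t within {0..})" if "j \<in> {1..N}" "t \<ge> 0" for j t
    using C2_half_line.deriv0[OF C2[OF that(1)] that(2)] .
  show "C2_half_line (centred \<theta> i) (centred \<omega> i) (centred \<alpha> i)"
  proof
    show "(centred \<theta> i has_real_derivative centred \<omega> i t) (at t within {0..})" if "t \<ge> 0" for t
      unfolding centred_def[abs_def] by (intro DERIV_diff DERIV_cmult DERIV_sum d0 i that)
    show "continuous_on {0..} (centred \<omega> i)"
      unfolding centred_def[abs_def] by (intro continuous_intros cont_omega i)
    show "(centred \<omega> i has_real_derivative centred \<alpha> i t) (at t)" if "t > 0" for t
      unfolding centred_def[abs_def] by (intro DERIV_diff DERIV_cmult DERIV_sum d_omega i that)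
  qed
  fix t :: real assume t: "t > 0"
  have "(\<Sum>j=1..N. m * \<alpha> j t + \<omega> j t) = (\<Sum>j=1..N. \<nu> j + \<kappa> * rot_im j t)"
    by (intro sum.cong refl ode_rot t)
  also have "\<dots> = (\<Sum>j=1..N. \<nu> j) + \<kappa> * (\<Sum>j=1..N. rot_im j t)"
    by (simp add: sum.distrib sum_distrib_left)
  finally have total: "m * (\<Sum>j=1..N. \<alpha> j t) + (\<Sum>j=1..N. \<omega> j t) = (\<Sum>j=1..N. \<nu> j)"
    unfolding sum_rot_im by (simp add: sum.distrib sum_distrib_left)
  have "m * centred \<alpha> i t + centred \<omega> i t = (m * \<alpha> i t + \<omega> i t)
      - 1 / real N * (m * (\<Sum>j=1..N. \<alpha> j t) + (\<Sum>j=1..N. \<omega> j t))"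
    unfolding centred_def by (simp add: algebra_simps add_divide_distrib)
  also have "\<dots> = \<nu> i - 1 / real N * (\<Sum>j=1..N. \<nu> j)
      + \<kappa> / real N * (\<Sum>j=1..N. sin (\<theta> j t - \<theta> i t))"
    unfolding total ode[OF i t] by simp
  also have "(\<Sum>j=1..N. sin (\<theta> j t - \<theta> i t)) = (\<Sum>j=1..N. sin (centred \<theta> j t - centred \<theta> i t))"
    unfolding centred_def by simp
  finally show "m * centred \<alpha> i t + centred \<omega> i t = \<nu> i - 1 / real N * (\<Sum>j=1..N. \<nu> j)
      + \<kappa> / real N * (\<Sum>j=1..N. sin (centred \<theta> j t - centred \<theta> i t))" .
qed

lemma phase_locking_if_bounded_differences:
  assumes bdd: "\<And>i j. i \<in> {1..N} \<Longrightarrow> j \<in> {1..N} \<Longrightarrow> \<exists>B. \<forall>t\<ge>0. \<bar>\<theta> i t - \<theta> j t\<bar> \<le> B"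
  shows "phase_locking N \<theta>"
proof -
  have "\<forall>i j. \<exists>B. i \<in> {1..N} \<longrightarrow> j \<in> {1..N} \<longrightarrow> (\<forall>t\<ge>0. \<bar>\<theta> i t - \<theta> j t\<bar> \<le> B)" using bdd by blast
  then obtain D where D: "\<And>i j t. i \<in> {1..N} \<Longrightarrow> j \<in> {1..N} \<Longrightarrow> t \<ge> 0 \<Longrightarrow> \<bar>\<theta> i t - \<theta> j t\<bar> \<le> D i j"
    by metis
  define B where "B = (\<Sum>i=1..N. \<bar>1 / real N * (\<Sum>j=1..N. D i j)\<bar>)"
  interpret c: bounded_kuramoto_path N m \<kappa> "\<lambda>i. \<nu> i - 1 / real N * (\<Sum>j=1..N. \<nu> j)"
    "centred \<theta>" "centred \<omega>" "centred \<alpha>" B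
  proof (intro bounded_kuramoto_path.intro centred_path bounded_kuramoto_path_axioms.intro)
    fix i and t :: real assume i: "i \<in> {1..N}" and t: "t \<ge> 0"
    have "centred \<theta> i t = 1 / real N * (\<Sum>j=1..N. \<theta> i t - \<theta> j t)"
      unfolding centred_def using N by (simp add: sum_subtractf right_diff_distrib)
    then have "\<bar>centred \<theta> i t\<bar> = 1 / real N * \<bar>\<Sum>j=1..N. \<theta> i t - \<theta> j t\<bar>" by (simp add: abs_mult)
    also have "\<dots> \<le> 1 / real N * (\<Sum>j=1..N. D i j)"
      by (intro mult_left_mono order_trans[OF sum_abs] sum_mono D i t) auto
    also have "\<dots> \<le> \<bar>1 / real N * (\<Sum>j=1..N. D i j)\<bar>" by (rule abs_ge_self)
    also have "\<dots> \<le> B" unfolding B_def using i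
      by (intro member_le_sum[of i "{1..N}" "\<lambda>i. \<bar>1 / real N * (\<Sum>j=1..N. D i j)\<bar>"]) auto
    finally show "\<bar>centred \<theta> i t\<bar> \<le> B" .
  qed
  have "centred \<theta> i t - centred \<theta> j t = \<theta> i t - \<theta> j t" for i j t unfolding centred_def by simp
  then show ?thesis using c.bounded_path_phase_locks unfolding phase_locking_def by simp
qed

end

theorem theoremD1:
  fixes N :: nat and m \<kappa> :: real and \<nu> \<theta>0 \<omega>0 :: "nat \<Rightarrow> real"
    and \<theta> :: "nat \<Rightarrow> real \<Rightarrow> real"
  assumes "N \<ge> 1" and "m > 0" and "\<kappa> \<ge> 0"
    and "inertial_kuramoto_solution N m \<kappa> \<nu> \<theta>0 \<omega>0 \<theta>"
  shows
    "(finite_collisions N \<theta> \<longrightarrow> phase_locking N \<theta>) \<and>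
     (phase_locking N \<theta> \<longrightarrow>
       (\<forall>i\<in>{1..N}. \<forall>j\<in>{1..N}. infinite {t. collide_at \<theta> i j t} \<longrightarrow>
          \<nu> i = \<nu> j \<and>
          (\<exists>L\<in>two_pi_ints. ((\<lambda>t. \<theta> i t - \<theta> j t) \<longlongrightarrow> L) at_top) \<and>
          m * \<kappa> > 1 / 4 \<and>
          (\<exists>C. ((\<lambda>t. 1 / real N * (\<Sum>l=1..N. cos (\<theta> l t - \<theta> i t))) \<longlongrightarrow> C) at_top \<and>
               m * \<kappa> * C \<ge> 1 / 4)) \<and>
       ((\<forall>i\<in>{1..N}. \<forall>j\<in>{1..N}. i \<noteq> j \<longrightarrow> \<nu> i \<noteq> \<nu> j) \<or>
        (\<forall>i\<in>{1..N}. \<forall>j\<in>{1..N}. i \<noteq> j \<and> \<nu> i = \<nu> j \<longrightarrow>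
           (\<exists>L. ((\<lambda>t. \<theta> i t - \<theta> j t) \<longlongrightarrow> L) at_top \<and> L \<notin> two_pi_ints)) \<or>
        m * \<kappa> \<le> 1 / 4 \<or>
        (\<forall>i\<in>{1..N}. \<forall>j\<in>{1..N}. i \<noteq> j \<and> \<nu> i = \<nu> j \<and>
           (\<exists>L\<in>two_pi_ints. ((\<lambda>t. \<theta> i t - \<theta> j t) \<longlongrightarrow> L) at_top) \<longrightarrow>
           (\<exists>C. ((\<lambda>t. 1 / real N * (\<Sum>l=1..N. cos (\<theta> l t - \<theta> i t))) \<longlongrightarrow> C) at_top \<and>
                m * \<kappa> * C < 1 / 4))
        \<longrightarrow> finite_collisions N \<theta>))"
proof -
  obtain \<omega> \<alpha> where sol: "\<forall>i\<in>{1..N}.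
       \<theta> i 0 = \<theta>0 i \<and> \<omega> i 0 = \<omega>0 i \<and>
       (\<forall>t\<ge>0. (\<theta> i has_real_derivative \<omega> i t) (at t within {0..})) \<and>
       continuous_on {0..} (\<omega> i) \<and>
       (\<forall>t>0. (\<omega> i has_real_derivative \<alpha> i t) (at t) \<and>
              m * \<alpha> i t + \<omega> i t = \<nu> i + \<kappa> / real N * (\<Sum>j=1..N. sin (\<theta> j t - \<theta> i t)))"
    using assms(4) unfolding inertial_kuramoto_solution_def by blast
  interpret kuramoto_path N m \<kappa> \<nu> \<theta> \<omega> \<alpha>
  proof (rule kuramoto_path.intro)
    show "C2_half_line (\<theta> i) (\<omega> i) (\<alpha> i)" if "i \<in> {1..N}" for i
      using sol that by unfold_locales blast+
    show "m * \<alpha> i t + \<omega> i t = \<nu> i + \<kappa> / real N * (\<Sum>j=1..N. sin (\<theta> j t - \<theta> i t))"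
      if "i \<in> {1..N}" "t > 0" for i t using sol that by blast
  qed (use assms in auto)
  have locks: "phase_locking N \<theta>" if "finite_collisions N \<theta>"
    using that unfolding finite_collisions_def
    by (intro phase_locking_if_bounded_differences bounded_difference_if_finite_collisions) auto
  let ?nec = "\<lambda>i j. \<nu> i = \<nu> j \<and>
      (\<exists>L\<in>two_pi_ints. ((\<lambda>t. \<theta> i t - \<theta> j t) \<longlongrightarrow> L) at_top) \<and>
      m * \<kappa> > 1 / 4 \<and>
      (\<exists>C. ((\<lambda>t. 1 / real N * (\<Sum>l=1..N. cos (\<theta> l t - \<theta> i t))) \<longlongrightarrow> C) at_top \<and> m * \<kappa> * C \<ge> 1 / 4)"
  have nec: "?nec i j" if pl: "phase_locking N \<theta>" and ij: "i \<in> {1..N}" "j \<in> {1..N}"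
    and inf: "infinite {t. collide_at \<theta> i j t}" for i j
  proof -
    obtain L where L: "((\<lambda>t. \<theta> i t - \<theta> j t) \<longlongrightarrow> L) at_top"
      using pl ij unfolding phase_locking_def by blast
    have "\<forall>l\<in>{1..N}. \<exists>D. ((\<lambda>t. \<theta> l t - \<theta> i t) \<longlongrightarrow> D) at_top"
      using pl ij(1) unfolding phase_locking_def by blast
    then obtain D where D: "\<And>l. l \<in> {1..N} \<Longrightarrow> ((\<lambda>t. \<theta> l t - \<theta> i t) \<longlongrightarrow> D l) at_top" by metis
    have C: "((\<lambda>t. 1 / real N * (\<Sum>l=1..N. cos (\<theta> l t - \<theta> i t))) \<longlongrightarrow> 1 / real N * (\<Sum>l=1..N. cos (D l))) at_top"
      by (intro tendsto_intros D)
    note facts = infinite_collisions_at_phase_locking[OF ij inf L C]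
    show ?thesis
      using facts(1,3) bexI[of "\<lambda>L. ((\<lambda>t. \<theta> i t - \<theta> j t) \<longlongrightarrow> L) at_top", OF L facts(2)]
        conjI[OF C facts(4)] by blast
  qed
  have irrefl: "i \<noteq> j" if "infinite {t. collide_at \<theta> i j t}" for i j
  proof
    assume "i = j"
    then have "{t. collide_at \<theta> i j t} = {}"
      using not_isolated_half_line by (simp add: collide_at_def rcong_refl atLeast_def)
    with that show False by simp
  qed
  have suff: "finite_collisions N \<theta>"
    if pl: "phase_locking N \<theta>" and h: "(\<forall>i\<in>{1..N}. \<forall>j\<in>{1..N}. i \<noteq> j \<longrightarrow> \<nu> i \<noteq> \<nu> j) \<or>
        (\<forall>i\<in>{1..N}. \<forall>j\<in>{1..N}. i \<noteq> j \<and> \<nu> i = \<nu> j \<longrightarrow>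
           (\<exists>L. ((\<lambda>t. \<theta> i t - \<theta> j t) \<longlongrightarrow> L) at_top \<and> L \<notin> two_pi_ints)) \<or>
        m * \<kappa> \<le> 1 / 4 \<or>
        (\<forall>i\<in>{1..N}. \<forall>j\<in>{1..N}. i \<noteq> j \<and> \<nu> i = \<nu> j \<and>
           (\<exists>L\<in>two_pi_ints. ((\<lambda>t. \<theta> i t - \<theta> j t) \<longlongrightarrow> L) at_top) \<longrightarrow>
           (\<exists>C. ((\<lambda>t. 1 / real N * (\<Sum>l=1..N. cos (\<theta> l t - \<theta> i t))) \<longlongrightarrow> C) at_top \<and>
                m * \<kappa> * C < 1 / 4))"
  proof (rule ccontr)
    assume "\<not> finite_collisions N \<theta>"
    then obtain i j where ij: "i \<in> {1..N}" "j \<in> {1..N}" and inf: "infinite {t. collide_at \<theta> i j t}"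
      unfolding finite_collisions_def by blast
    note ne = irrefl[OF inf]
    obtain L C where n: "\<nu> i = \<nu> j" "L \<in> two_pi_ints" "((\<lambda>t. \<theta> i t - \<theta> j t) \<longlongrightarrow> L) at_top"
      "m * \<kappa> > 1 / 4" "((\<lambda>t. 1 / real N * (\<Sum>l=1..N. cos (\<theta> l t - \<theta> i t))) \<longlongrightarrow> C) at_top"
      "m * \<kappa> * C \<ge> 1 / 4"
      using nec[OF pl ij inf] by blast
    from h show False
    proof (elim disjE)
      assume "\<forall>i\<in>{1..N}. \<forall>j\<in>{1..N}. i \<noteq> j \<and> \<nu> i = \<nu> j \<longrightarrow>
           (\<exists>L. ((\<lambda>t. \<theta> i t - \<theta> j t) \<longlongrightarrow> L) at_top \<and> L \<notin> two_pi_ints)"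
      then obtain L' where "((\<lambda>t. \<theta> i t - \<theta> j t) \<longlongrightarrow> L') at_top" "L' \<notin> two_pi_ints"
        using ij ne n(1) by blast
      then show False using tendsto_unique[OF trivial_limit_at_top_linorder _ n(3)] n(2) by blast
    next
      assume "\<forall>i\<in>{1..N}. \<forall>j\<in>{1..N}. i \<noteq> j \<and> \<nu> i = \<nu> j \<and>
           (\<exists>L\<in>two_pi_ints. ((\<lambda>t. \<theta> i t - \<theta> j t) \<longlongrightarrow> L) at_top) \<longrightarrow>
           (\<exists>C. ((\<lambda>t. 1 / real N * (\<Sum>l=1..N. cos (\<theta> l t - \<theta> i t))) \<longlongrightarrow> C) at_top \<and>
                m * \<kappa> * C < 1 / 4)"
      then obtain C' where C': "((\<lambda>t. 1 / real N * (\<Sum>l=1..N. cos (\<theta> l t - \<theta> i t))) \<longlongrightarrow> C') at_top"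
        "m * \<kappa> * C' < 1 / 4"
        using ij ne n(1-3) by blast
      then have "C' = C" using tendsto_unique[OF trivial_limit_at_top_linorder _ n(5)] by blast
      then show False using C'(2) n(6) by simp
    qed (use ij ne n(1,4) in auto)
  qed
  show ?thesis using locks nec suff by blast
qed

end
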